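(* Let $R=(r_{ij})$ be a real symmetric $n\times n$ matrix with zero diagonal and $\rho(|R|)<1$, let $G$ be its graph, assumed to contain a cycle, with girth $g$, and let $Z=\det(I-R)^{-1}$ and $Z^{\mathrm{bp}}$ be the belief-propagation estimate (defined in the context). Then $$\frac1n\left|\log\frac{Z^{\mathrm{bp}}}{Z}\right|\le\frac{\rho(|R|)^g}{g\,(1-\rho(|R|))}.$$
   Context: $|R|=(|r_{ij}|)$ is the entrywise absolute value and $\rho$ the spectral radius. $G$ is the graph on $V=\{1,\dots,n\}$ with undirected edge $\{i,j\}$ whenever $r_{ij}\neq0$; $\partial i$ is the set of neighbours of $i$. The girth $g$ is the length of the shortest cycle of $G$. GaBP messages: for each directed edge $(ij)$ ($\{i,j\}\in G$), $\alpha_{ij}=\lim_t\alpha^{(t)}_{ij}$ with $\alpha^{(0)}_{ij}=0$, $\alpha^{(t+1)}_{ij}=r_{ij}^2(1-\sum_{k\in\partial i\setminus j}\alpha^{(t)}_{ki})^{-1}$ (convergent when $\rho(|R|)<1$). $\alpha_{i\setminus j}=\sum_{k\in\partial i\setminus j}\alpha_{ki}$. $Z_i^{\mathrm{bp}}=(1-\sum_{k\in\partial i}\alpha_{ki})^{-1}$, $Z_{ij}^{\mathrm{bp}}=\det\begin{pmatrix}1-\alpha_{i\setminus j} & -r_{ij}\\ -r_{ij} & 1-\alpha_{j\setminus i}\end{pmatrix}^{-1}$, and $Z^{\mathrm{bp}}=\prod_{i\in V}Z_i^{\mathrm{bp}}\prod_{\{i,j\}\in G}\frac{Z_{ij}^{\mathrm{bp}}}{Z_i^{\mathrm{bp}}Z_j^{\mathrm{bp}}}$.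 *)

theory Defs
  imports Complex_Main "Jordan_Normal_Form.Spectral_Radius" "Jordan_Normal_Form.Determinant"
begin

text \<open>Real n x n matrices are JNF matrices R \<in> carrier_mat n n, vertices are 0..<n.\<close>

definition abs_mat :: "real mat \<Rightarrow> real mat" where
  "abs_mat R = map_mat abs R"

definition rho_abs :: "real mat \<Rightarrow> real" where
  "rho_abs R = spectral_radius (map_mat complex_of_real (abs_mat R))"

definition gedge :: "real mat \<Rightarrow> nat \<Rightarrow> nat \<Rightarrow> bool" where
  "gedge R i j \<longleftrightarrow> i < dim_row R \<and> j < dim_row R \<and> i \<noteq> j \<and> R $$ (i, j) \<noteq> 0"

definition nbrs :: "real mat \<Rightarrow> nat \<Rightarrow> nat set" where
  "nbrs R i = {k. gedge R i k}"

definition has_cycle_of_length :: "real mat \<Rightarrow> nat \<Rightarrow> bool" where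
  "has_cycle_of_length R k \<longleftrightarrow> 3 \<le> k \<and>
     (\<exists>v :: nat \<Rightarrow> nat. inj_on v {..<k} \<and> (\<forall>i<k. gedge R (v i) (v (Suc i mod k))))"

definition has_cycle :: "real mat \<Rightarrow> bool" where
  "has_cycle R \<longleftrightarrow> (\<exists>k. has_cycle_of_length R k)"

definition girth :: "real mat \<Rightarrow> nat" where
  "girth R = (LEAST k. has_cycle_of_length R k)"

text \<open>GaBP iterates alpha^(t)_{ij} (message along directed edge (ij)).\<close>
fun alpha_iter :: "real mat \<Rightarrow> nat \<Rightarrow> nat \<Rightarrow> nat \<Rightarrow> real" where
  "alpha_iter R 0 i j = 0"
| "alpha_iter R (Suc t) i j =
     (R $$ (i, j))\<^sup>2 * inverse (1 - (\<Sum>k\<in>nbrs R i - {j}. alpha_iter R t k i))"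

definition alpha :: "real mat \<Rightarrow> nat \<Rightarrow> nat \<Rightarrow> real" where
  "alpha R i j = lim (\<lambda>t. alpha_iter R t i j)"

definition alpha_excl :: "real mat \<Rightarrow> nat \<Rightarrow> nat \<Rightarrow> real" where
  "alpha_excl R i j = (\<Sum>k\<in>nbrs R i - {j}. alpha R k i)"

definition Z_node :: "real mat \<Rightarrow> nat \<Rightarrow> real" where
  "Z_node R i = inverse (1 - (\<Sum>k\<in>nbrs R i. alpha R k i))"

definition Z_edge :: "real mat \<Rightarrow> nat \<Rightarrow> nat \<Rightarrow> real" where
  "Z_edge R i j = inverse (det (mat_of_rows_list 2
      [[1 - alpha_excl R i j, - R $$ (i, j)], [- R $$ (i, j), 1 - alpha_excl R j i]]))"

definition Z_bp :: "real mat \<Rightarrow> real" where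
  "Z_bp R = (\<Prod>i<dim_row R. Z_node R i) *
     (\<Prod>(i, j)\<in>{(i, j). i < j \<and> gedge R i j}. Z_edge R i j / (Z_node R i * Z_node R j))"

definition Z_exact :: "real mat \<Rightarrow> real" where
  "Z_exact R = inverse (det (1\<^sub>m (dim_row R) - R))"

end

theory Submission
  imports "HOL-Analysis.Complex_Transcendental" Defs
begin

text \<open>
  Write \<open>\<alpha>\<^sub>i\<^sub>j\<close> for the limiting messages, \<open>w\<^sub>i\<^sub>j = r\<^sub>i\<^sub>j / (1 - \<alpha>\<^bsub>i\<setminus>j\<^esub>)\<close> and let \<open>M\<close> be the
  non-backtracking matrix on directed edges with weights \<open>w\<close>. An Ihara-Bass type determinant identity
  gives \<open>Z\<^sup>b\<^sup>p / Z = det (I - M)\<close>, so the logarithm is \<open>- \<Sum>\<^sub>k tr M\<^sup>k / k\<close>. A closed non-backtracking walk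
  contains a cycle, so only \<open>k \<ge> g\<close> contributes, and replacing \<open>R\<close> by \<open>|R|\<close> the modulus is at most
  \<open>(1/g) \<Sum>\<^sub>k tr |M|\<^sup>k\<close>. By the Woodbury identity the latter sum is at most
  \<open>tr (I - |R|)\<^sup>-\<^sup>1 - \<Sum>\<^sub>i Z\<^sub>i\<close>, so it remains to show \<open>\<Sum>\<^sub>i Z\<^sub>i \<ge> \<Sum>\<^bsub>k<g\<^esub> tr |R|\<^sup>k\<close>. For this, replace \<open>R\<close> by \<open>t R\<close>
  with \<open>0 < t \<le> 1\<close>: the difference \<open>tr (I - t|R|)\<^sup>-\<^sup>1 - \<Sum>\<^sub>i Z\<^sub>i(t)\<close> is \<open>O(t\<^sup>g)\<close>, and \<open>Z\<^sub>i(t)\<close> agrees up to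
  \<open>O(t\<^sup>g)\<close> with a polynomial minorant having nonnegative coefficients; summed over \<open>i\<close>, its coefficient
  of \<open>t\<^sup>k\<close> must therefore be \<open>tr |R|\<^sup>k\<close> for \<open>k < g\<close>, and \<open>t = 1\<close> gives the claim. Finally \<open>tr |R|\<^sup>k \<le> n \<rho>\<^sup>k\<close>.
\<close>

subsection \<open>Traces, eigenvalues and determinants\<close>

lemma mat_mult_entry:
  assumes "A \<in> carrier_mat a b" "B \<in> carrier_mat b c" "i < a" "j < c"
  shows "(A * B) $$ (i, j) = (\<Sum>k<b. A $$ (i, k) * B $$ (k, j))"
  using assms by (auto simp: scalar_prod_def atLeast0LessThan)

definition mat_trace :: "'a :: comm_monoid_add mat \<Rightarrow> 'a" where
  "mat_trace A = (\<Sum>i<dim_row A. A $$ (i, i))"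

lemma mat_trace_mult_commute:
  fixes A :: "'a :: comm_semiring_0 mat"
  assumes "A \<in> carrier_mat a b" "B \<in> carrier_mat b a"
  shows "mat_trace (A * B) = mat_trace (B * A)"
proof -
  have "mat_trace (A * B) = (\<Sum>i<a. \<Sum>k<b. A $$ (i, k) * B $$ (k, i))"
    using assms by (auto simp: mat_trace_def mat_mult_entry[OF assms] simp del: index_mult_mat(1))
  also have "\<dots> = (\<Sum>k<b. \<Sum>i<a. B $$ (k, i) * A $$ (i, k))"
    by (subst sum.swap) (simp add: mult.commute)
  also have "\<dots> = mat_trace (B * A)"
    using assms by (auto simp: mat_trace_def mat_mult_entry[OF assms(2,1)] simp del: index_mult_mat(1))
  finally show ?thesis .
qed

lemma upper_triangular_pow:
  fixes B :: "'a :: comm_semiring_1 mat"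
  assumes B: "B \<in> carrier_mat n n" "upper_triangular B"
  shows "upper_triangular (B ^\<^sub>m k) \<and> (\<forall>i<n. (B ^\<^sub>m k) $$ (i, i) = (B $$ (i, i)) ^ k)"
proof (induction k)
  case 0
  then show ?case using B by auto
next
  case (Suc k)
  have C: "B ^\<^sub>m k \<in> carrier_mat n n" using B by auto
  have e: "(B ^\<^sub>m k * B) $$ (i, j) = (\<Sum>l<n. (B ^\<^sub>m k) $$ (i, l) * B $$ (l, j))" if "i < n" "j < n" for i j
    by (rule mat_mult_entry[OF C B(1) that])
  have l: "(B ^\<^sub>m k) $$ (i, l) = 0" if "l < i" "i < n" for i l
    using Suc C that by (auto elim!: upper_triangularD)
  have l': "B $$ (i, l) = 0" if "l < i" "i < n" for i l
    using B that by (auto elim!: upper_triangularD)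
  have t: "(B ^\<^sub>m k) $$ (i, l) * B $$ (l, j) = 0" if "j < i \<or> (i = j \<and> l \<noteq> i)" "i < n" "l < n" for i j l
    using l[of l i] l'[of j l] that by (cases "l < i") auto
  have "upper_triangular (B ^\<^sub>m k * B)"
    using C B by (auto simp: e t simp del: index_mult_mat(1) intro!: sum.neutral)
  moreover have "(B ^\<^sub>m k * B) $$ (i, i) = (B $$ (i, i)) ^ Suc k" if "i < n" for i
  proof -
    have "(\<Sum>l<n. (B ^\<^sub>m k) $$ (i, l) * B $$ (l, i)) = (\<Sum>l\<in>{i}. (B ^\<^sub>m k) $$ (i, l) * B $$ (l, i))"
      by (rule sum.mono_neutral_right) (use that t in auto)
    then show ?thesis using Suc that by (simp add: e mult.commute del: index_mult_mat(1))
  qed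
  ultimately show ?case by simp
qed

text \<open>Schur triangularisation puts the eigenvalues with multiplicity on a diagonal, so a
  single list \<open>es\<close> yields the determinant and all power traces at once.\<close>

lemma complex_mat_eigenvalue_list:
  fixes A :: "complex mat"
  assumes A: "A \<in> carrier_mat n n"
  obtains es where "length es = n" "\<And>e. e \<in> set es \<Longrightarrow> eigenvalue A e"
    "det (1\<^sub>m n - A) = (\<Prod>e\<leftarrow>es. 1 - e)" "\<And>k. mat_trace (A ^\<^sub>m k) = (\<Sum>e\<leftarrow>es. e ^ k)"
proof -
  obtain es where es: "char_poly A = (\<Prod>a\<leftarrow>es. [:- a, 1:])" "length es = n"
    using char_poly_factorized[OF A] by blast
  obtain B P Q where "schur_decomposition A es = (B, P, Q)"
    by (cases "schur_decomposition A es") auto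
  from schur_decomposition[OF A es(1) this]
  have wit: "similar_mat_wit A B P Q" and ut: "upper_triangular B" and diag: "diag_mat B = es" by auto
  note w = similar_mat_witD2[OF A wit]
  have B: "B \<in> carrier_mat n n" and P: "P \<in> carrier_mat n n" and Q: "Q \<in> carrier_mat n n"
    using w by auto
  have esn: "es = map (\<lambda>i. B $$ (i, i)) [0..<n]" using diag B by (auto simp: diag_mat_def)
  have ev: "eigenvalue A e" if "e \<in> set es" for e
    unfolding eigenvalue_root_char_poly[OF A] es(1) poly_prod_list
    using that by (auto simp: prod_list_zero_iff o_def)
  have "1\<^sub>m n - A = P * (1\<^sub>m n - B) * Q"
  proof -
    have "P * (1\<^sub>m n - B) * Q = (P - P * B) * Q"
      using B P Q by (subst mult_minus_distrib_mat[OF P _ B]) auto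
    also have "\<dots> = P * Q - P * B * Q" using B P Q by (intro minus_mult_distrib_mat) auto
    finally show ?thesis using w by simp
  qed
  then have "similar_mat (1\<^sub>m n - A) (1\<^sub>m n - B)"
    using w A by (intro similar_matI[of _ _ P Q n]) auto
  then have "det (1\<^sub>m n - A) = det (1\<^sub>m n - B)" by (rule det_similar)
  also have "\<dots> = prod_list (diag_mat (1\<^sub>m n - B))"
    by (rule det_upper_triangular[of _ n]) (use B ut in \<open>auto intro!: upper_triangularI elim!: upper_triangularD\<close>)
  also have "diag_mat (1\<^sub>m n - B) = map (\<lambda>e. 1 - e) es" using B by (auto simp: esn diag_mat_def)
  finally have det: "det (1\<^sub>m n - A) = (\<Prod>e\<leftarrow>es. 1 - e)" .
  have tr: "mat_trace (A ^\<^sub>m k) = (\<Sum>e\<leftarrow>es. e ^ k)" for k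
  proof -
    have "A ^\<^sub>m k = P * B ^\<^sub>m k * Q" by (rule similar_mat_wit_pow_id[OF wit])
    then have "mat_trace (A ^\<^sub>m k) = mat_trace (Q * (P * B ^\<^sub>m k))"
      using mat_trace_mult_commute[of "P * B ^\<^sub>m k" n n Q] P Q B by simp
    also have "Q * (P * B ^\<^sub>m k) = Q * P * B ^\<^sub>m k"
      using P Q B by (intro assoc_mult_mat[symmetric]) auto
    also have "\<dots> = B ^\<^sub>m k" using w B by simp
    also have "mat_trace \<dots> = (\<Sum>i<n. (B $$ (i, i)) ^ k)"
      using upper_triangular_pow[OF B ut, of k] B by (simp add: mat_trace_def)
    finally show ?thesis
      by (simp add: esn o_def interv_sum_list_conv_sum_set_nat atLeast0LessThan)
  qed
  show ?thesis using that[of es] es(2) ev det tr by blast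
qed

lemma norm_mat_trace_pow_le:
  fixes A :: "complex mat"
  assumes A: "A \<in> carrier_mat n n" and c: "\<And>e. eigenvalue A e \<Longrightarrow> norm e \<le> c"
  shows "norm (mat_trace (A ^\<^sub>m k)) \<le> n * c ^ k"
proof -
  obtain es where es: "length es = n" "\<And>e. e \<in> set es \<Longrightarrow> eigenvalue A e"
    "\<And>k. mat_trace (A ^\<^sub>m k) = (\<Sum>e\<leftarrow>es. e ^ k)"
    using complex_mat_eigenvalue_list[OF A] by metis
  have "norm (\<Sum>e\<leftarrow>es. e ^ k) \<le> (\<Sum>e\<leftarrow>es. c ^ k)" if "\<And>e. e \<in> set es \<Longrightarrow> norm e \<le> c" for es :: "complex list"
    using that
  proof (induction es)
    case (Cons e es)
    have "norm (e ^ k) \<le> c ^ k" using Cons.prems[of e] by (simp add: norm_power power_mono)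
    then show ?case using Cons by (auto intro!: order_trans[OF norm_triangle_ineq] add_mono)
  qed simp
  then have "norm (\<Sum>e\<leftarrow>es. e ^ k) \<le> (\<Sum>e\<leftarrow>es. c ^ k)" using es c by auto
  then show ?thesis using es by (simp add: sum_list_triv)
qed

lemma mat_trace_map_mat:
  "A \<in> carrier_mat n n \<Longrightarrow> mat_trace (map_mat complex_of_real A) = complex_of_real (mat_trace A)"
  by (auto simp: mat_trace_def)

lemma map_mat_of_real_pow:
  "A \<in> carrier_mat n n \<Longrightarrow> map_mat complex_of_real A ^\<^sub>m k = map_mat complex_of_real (A ^\<^sub>m k)"
  by (rule of_real_hom.mat_hom_pow[symmetric])

text \<open>The logarithm series of \<open>1 - e\<close> is summed over the eigenvalues
  \<open>e\<close>. The term with \<open>k = 0\<close> is 0, as division by zero gives 0.\<close>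

lemma ln_det_one_minus_series:
  fixes A :: "real mat"
  assumes A: "A \<in> carrier_mat n n"
    and c: "\<And>e. eigenvalue (map_mat complex_of_real A) e \<Longrightarrow> norm e < 1"
  shows "det (1\<^sub>m n - A) > 0" "(\<lambda>k. mat_trace (A ^\<^sub>m k) / k) sums (- ln (det (1\<^sub>m n - A)))"
proof -
  let ?A = "map_mat complex_of_real A"
  have cA: "?A \<in> carrier_mat n n" using A by simp
  obtain es where es: "length es = n" "\<And>e. e \<in> set es \<Longrightarrow> eigenvalue ?A e"
    "det (1\<^sub>m n - ?A) = (\<Prod>e\<leftarrow>es. 1 - e)" "\<And>k. mat_trace (?A ^\<^sub>m k) = (\<Sum>e\<leftarrow>es. e ^ k)"
    using complex_mat_eigenvalue_list[OF cA] by metis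
  have tr: "complex_of_real (mat_trace (A ^\<^sub>m k)) = (\<Sum>e\<leftarrow>es. e ^ k)" for k
    using es(4)[of k] mat_trace_map_mat[of "A ^\<^sub>m k" n] A by (simp add: map_mat_of_real_pow)
  have "1\<^sub>m n - ?A = map_mat complex_of_real (1\<^sub>m n - A)"
    using A by (auto simp: one_mat_def)
  then have dt: "complex_of_real (det (1\<^sub>m n - A)) = (\<Prod>e\<leftarrow>es. 1 - e)"
    using es(3) by (simp add: of_real_hom.hom_det)
  have "(\<lambda>k. (\<Sum>e\<leftarrow>es. e ^ k) / of_nat k) sums (- (\<Sum>e\<leftarrow>es. Ln (1 - e))) \<and>
      exp (\<Sum>e\<leftarrow>es. Ln (1 - e)) = (\<Prod>e\<leftarrow>es. 1 - e)" if "\<And>e. e \<in> set es \<Longrightarrow> norm e < 1" for es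
    using that
  proof (induction es)
    case (Cons e es)
    have "norm e < 1" using Cons.prems by simp
    then have "1 - e \<noteq> 0" by auto
    have "(\<lambda>k. - (- (e ^ k / of_nat k))) sums - Ln (1 - e)"
      using sums_minus[OF Ln_series'[of "-e"]] \<open>norm e < 1\<close> by simp
    then have "(\<lambda>k. e ^ k / of_nat k + (\<Sum>e\<leftarrow>es. e ^ k) / of_nat k) sums (- Ln (1 - e) + - (\<Sum>e\<leftarrow>es. Ln (1 - e)))"
      using Cons by (intro sums_add) auto
    then show ?case using Cons \<open>1 - e \<noteq> 0\<close> by (auto simp: add_divide_distrib exp_add)
  qed simp
  from this[of es] es(2) c
  have s: "(\<lambda>k. complex_of_real (mat_trace (A ^\<^sub>m k) / k)) sums (- (\<Sum>e\<leftarrow>es. Ln (1 - e)))"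
    and ex: "exp (\<Sum>e\<leftarrow>es. Ln (1 - e)) = complex_of_real (det (1\<^sub>m n - A))"
    by (auto simp: tr dt)
  \<comment> \<open>The complex logarithms sum to the limit of a real series, so their sum is real;
    the determinant is then the exponential of a real number, hence positive.\<close>
  define S where "S = (\<Sum>k. mat_trace (A ^\<^sub>m k) / k)"
  have "summable (\<lambda>k. mat_trace (A ^\<^sub>m k) / k)"
    using s summable_complex_of_real sums_summable by blast
  then have S: "(\<lambda>k. mat_trace (A ^\<^sub>m k) / k) sums S" by (simp add: S_def summable_sums)
  then have "(\<lambda>k. complex_of_real (mat_trace (A ^\<^sub>m k) / k)) sums complex_of_real S"
    by (rule sums_of_real)
  with s have "- (\<Sum>e\<leftarrow>es. Ln (1 - e)) = complex_of_real S" by (rule sums_unique2)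
  then have "complex_of_real (exp (- S)) = complex_of_real (det (1\<^sub>m n - A))"
    using ex by (metis exp_of_real minus_equation_iff of_real_minus)
  then have e: "exp (- S) = det (1\<^sub>m n - A)" using of_real_eq_iff by blast
  then show "det (1\<^sub>m n - A) > 0" by (metis exp_gt_zero)
  have "- ln (det (1\<^sub>m n - A)) = S" unfolding e[symmetric] by simp
  then show "(\<lambda>k. mat_trace (A ^\<^sub>m k) / k) sums (- ln (det (1\<^sub>m n - A)))" using S by simp
qed

subsection \<open>Nonnegative matrices contracting a positive weight\<close>

lemma strict_weight_imp_contraction:
  fixes b :: "nat \<Rightarrow> nat \<Rightarrow> real"
  assumes u: "\<And>i. i < n \<Longrightarrow> u i > 0" and lt: "\<And>i. i < n \<Longrightarrow> (\<Sum>j<n. b i j * u j) < u i"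
  obtains c where "0 \<le> c" "c < 1" "\<And>i. i < n \<Longrightarrow> (\<Sum>j<n. b i j * u j) \<le> c * u i"
proof -
  \<comment> \<open>Finitely many rows turn strict inequalities into a uniform factor; the inserted
    0 keeps \<open>c\<close> nonnegative and the maximum defined for \<open>n = 0\<close>.\<close>
  define c where "c = Max (insert 0 ((\<lambda>i. (\<Sum>j<n. b i j * u j) / u i) ` {..<n}))"
  have "0 \<le> c" unfolding c_def by (rule Max_ge) auto
  moreover have "c < 1" unfolding c_def by (subst Max_less_iff) (auto simp: u lt)
  moreover have "(\<Sum>j<n. b i j * u j) \<le> c * u i" if "i < n" for i
  proof -
    have "(\<Sum>j<n. b i j * u j) / u i \<le> c" unfolding c_def by (rule Max_ge) (use that in auto)
    then show ?thesis using u[OF that] by (simp add: pos_divide_le_eq)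
  qed
  ultimately show ?thesis using that by blast
qed

section \<open>Entrywise bounds for matrix powers\<close>

lemma pow_mat_commute:
  "A \<in> carrier_mat n n \<Longrightarrow> A ^\<^sub>m k * A = A * A ^\<^sub>m k"
proof (induction k)
  case (Suc k)
  have "A ^\<^sub>m Suc k * A = (A * A ^\<^sub>m k) * A" using Suc by simp
  also have "\<dots> = A * (A ^\<^sub>m k * A)" using Suc.prems by (intro assoc_mult_mat) auto
  finally show ?case by simp
qed auto

lemma pow_mat_smult:
  fixes A :: "'a :: comm_ring_1 mat"
  assumes A: "A \<in> carrier_mat n n"
  shows "(c \<cdot>\<^sub>m A) ^\<^sub>m k = c ^ k \<cdot>\<^sub>m (A ^\<^sub>m k)"
proof (induction k)
  case (Suc k)
  have "(c \<cdot>\<^sub>m A) ^\<^sub>m Suc k = (c ^ k \<cdot>\<^sub>m (A ^\<^sub>m k)) * (c \<cdot>\<^sub>m A)" using Suc by simp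
  also have "\<dots> = c \<cdot>\<^sub>m ((c ^ k \<cdot>\<^sub>m (A ^\<^sub>m k)) * A)"
    by (rule mult_smult_distrib[of _ n n _ n]) (use A in auto)
  also have "(c ^ k \<cdot>\<^sub>m (A ^\<^sub>m k)) * A = c ^ k \<cdot>\<^sub>m (A ^\<^sub>m k * A)"
    by (rule mult_smult_assoc_mat[of _ n n _ n]) (use A in auto)
  finally show ?case by (auto intro!: eq_matI simp: mult.assoc)
qed (use A in auto)

text \<open>Each multiplication contributes one factor \<open>t\<close>, which is what the later
  replacement of \<open>R\<close> by \<open>t R\<close> requires.\<close>

lemma abs_pow_mat_le_scaled:
  fixes A B :: "real mat"
  assumes A: "A \<in> carrier_mat n n" and B: "B \<in> carrier_mat n n"
    and le: "\<And>i j. i < n \<Longrightarrow> j < n \<Longrightarrow> \<bar>A $$ (i, j)\<bar> \<le> t * B $$ (i, j)"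
  shows "i < n \<Longrightarrow> j < n \<Longrightarrow> \<bar>(A ^\<^sub>m k) $$ (i, j)\<bar> \<le> t ^ k * (B ^\<^sub>m k) $$ (i, j)"
proof (induction k arbitrary: j)
  case (Suc k)
  have "\<bar>(A ^\<^sub>m Suc k) $$ (i, j)\<bar> \<le> (\<Sum>l<n. \<bar>(A ^\<^sub>m k) $$ (i, l)\<bar> * \<bar>A $$ (l, j)\<bar>)"
    using mat_mult_entry[of "A ^\<^sub>m k" n n A n i j] A Suc.prems
    by (simp add: abs_mult[symmetric] sum_abs del: index_mult_mat(1))
  also have "\<dots> \<le> (\<Sum>l<n. (t ^ k * (B ^\<^sub>m k) $$ (i, l)) * (t * B $$ (l, j)))"
    using Suc le by (intro sum_mono mult_mono) (auto intro: order_trans[OF abs_ge_zero])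
  also have "\<dots> = t ^ Suc k * (B ^\<^sub>m Suc k) $$ (i, j)"
    using mat_mult_entry[of "B ^\<^sub>m k" n n B n i j] B Suc.prems
    by (simp add: sum_distrib_left algebra_simps del: index_mult_mat(1))
  finally show ?case .
qed (use A B in auto)

lemma abs_pow_mat_le:
  fixes A B :: "real mat"
  assumes "A \<in> carrier_mat n n" "B \<in> carrier_mat n n"
    and "\<And>i j. i < n \<Longrightarrow> j < n \<Longrightarrow> \<bar>A $$ (i, j)\<bar> \<le> B $$ (i, j)"
    and "i < n" "j < n"
  shows "\<bar>(A ^\<^sub>m k) $$ (i, j)\<bar> \<le> (B ^\<^sub>m k) $$ (i, j)"
  using abs_pow_mat_le_scaled[of A n B 1 i j k] assms by simp

text \<open>The eigenvalue equation is read at an index where the ratio of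
  \<open>norm (x $ i)\<close> to \<open>u i\<close> is largest; there the weighted row sum bounds
  \<open>norm e\<close>.\<close>

lemma eigenvalue_le_weight:
  fixes A B :: "real mat"
  assumes A: "A \<in> carrier_mat n n"
    and le: "\<And>i j. i < n \<Longrightarrow> j < n \<Longrightarrow> \<bar>A $$ (i, j)\<bar> \<le> B $$ (i, j)"
    and u: "\<And>i. i < n \<Longrightarrow> u i > 0"
    and Bu: "\<And>i. i < n \<Longrightarrow> (\<Sum>j<n. B $$ (i, j) * u j) \<le> c * u i"
    and e: "eigenvalue (map_mat complex_of_real A) e"
  shows "norm e \<le> c"
proof -
  obtain x where x: "x \<in> carrier_vec n" "x \<noteq> 0\<^sub>v n" "map_mat complex_of_real A *\<^sub>v x = e \<cdot>\<^sub>v x"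
    using e A by (auto simp: eigenvalue_def eigenvector_def)
  obtain i0 where i0: "i0 < n" "x $ i0 \<noteq> 0" using x(1,2) by (metis carrier_vecD eq_vecI index_zero_vec)
  define m where "m = Max ((\<lambda>i. norm (x $ i) / u i) ` {..<n})"
  have m: "norm (x $ i) \<le> m * u i" if "i < n" for i
  proof -
    have "norm (x $ i) / u i \<le> m" unfolding m_def by (rule Max_ge) (use that in auto)
    then show ?thesis using u[OF that] by (simp add: pos_divide_le_eq)
  qed
  have "m \<in> (\<lambda>i. norm (x $ i) / u i) ` {..<n}" unfolding m_def by (rule Max_in) (use i0 in auto)
  then obtain i where i: "i < n" "m = norm (x $ i) / u i" by auto
  have mi: "norm (x $ i) = m * u i" using i u[OF i(1)] by simp
  have "0 < m * u i0" using m[OF i0(1)] i0 by (meson less_le_trans zero_less_norm_iff)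
  then have "m > 0" using u[OF i0(1)] by (simp add: zero_less_mult_iff)
  have "e * x $ i = (\<Sum>j<n. complex_of_real (A $$ (i, j)) * x $ j)"
    using arg_cong[OF x(3), of "\<lambda>w. w $ i"] i(1) A x(1)
    by (auto simp: scalar_prod_def atLeast0LessThan)
  then have "norm e * norm (x $ i) \<le> (\<Sum>j<n. \<bar>A $$ (i, j)\<bar> * norm (x $ j))"
    by (metis (mono_tags, lifting) norm_mult norm_of_real sum.cong norm_sum)
  also have "\<dots> \<le> (\<Sum>j<n. B $$ (i, j) * (m * u j))"
    using le[OF i(1)] m by (intro sum_mono mult_mono) (auto intro: order_trans[OF abs_ge_zero])
  also have "\<dots> = m * (\<Sum>j<n. B $$ (i, j) * u j)" by (simp add: sum_distrib_left algebra_simps)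
  also have "\<dots> \<le> m * (c * u i)" using Bu[OF i(1)] \<open>m > 0\<close> by (intro mult_left_mono) auto
  also have "\<dots> = c * norm (x $ i)" by (simp add: mi)
  finally show ?thesis using \<open>m > 0\<close> u[OF i(1)] mi by simp
qed

text \<open>The weight \<open>u\<close> makes \<open>B\<close> a contraction in a weighted maximum
  norm. Geometric decay of powers and the Neumann series then follow from elementary estimates, with
  no reference to eigenvalues.\<close>

locale weighted_contraction =
  fixes n :: nat and B :: "real mat" and u :: "nat \<Rightarrow> real" and c :: real
  assumes carrier: "B \<in> carrier_mat n n"
    and nonneg: "\<And>i j. i < n \<Longrightarrow> j < n \<Longrightarrow> B $$ (i, j) \<ge> 0"
    and weight_pos: "\<And>i. i < n \<Longrightarrow> u i > 0"
    and contr: "\<And>i. i < n \<Longrightarrow> (\<Sum>j<n. B $$ (i, j) * u j) \<le> c * u i"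
    and c_nonneg: "0 \<le> c" and c_less: "c < 1"
begin

lemma pow_carrier [simp]: "B ^\<^sub>m k \<in> carrier_mat n n"
  using carrier by simp

lemma pow_Suc_entry:
  "i < n \<Longrightarrow> j < n \<Longrightarrow> (B ^\<^sub>m Suc k) $$ (i, j) = (\<Sum>l<n. (B ^\<^sub>m k) $$ (i, l) * B $$ (l, j))"
  using mat_mult_entry[of "B ^\<^sub>m k" n n B n i j] carrier by (simp del: index_mult_mat(1))

lemma pow_nonneg: "i < n \<Longrightarrow> j < n \<Longrightarrow> (B ^\<^sub>m k) $$ (i, j) \<ge> 0"
  using abs_pow_mat_le[OF carrier carrier, of i j k] nonneg by simp

lemma pow_weight_le: "i < n \<Longrightarrow> (\<Sum>j<n. (B ^\<^sub>m k) $$ (i, j) * u j) \<le> c ^ k * u i"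
proof (induction k)
  case 0
  have "(\<Sum>j<n. (B ^\<^sub>m 0) $$ (i, j) * u j) = (\<Sum>j<n. if j = i then u j else 0)"
    using carrier 0 by (intro sum.cong) auto
  then show ?case using 0 by simp
next
  case (Suc k)
  have "(\<Sum>j<n. (B ^\<^sub>m Suc k) $$ (i, j) * u j) = (\<Sum>j<n. \<Sum>l<n. (B ^\<^sub>m k) $$ (i, l) * (B $$ (l, j) * u j))"
    using Suc.prems by (intro sum.cong) (auto simp: pow_Suc_entry sum_distrib_right mult.assoc simp del: pow_mat.simps)
  also have "\<dots> = (\<Sum>l<n. (B ^\<^sub>m k) $$ (i, l) * (\<Sum>j<n. B $$ (l, j) * u j))"
    by (subst sum.swap) (simp add: sum_distrib_left)
  also have "\<dots> \<le> (\<Sum>l<n. (B ^\<^sub>m k) $$ (i, l) * (c * u l))"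
    using Suc.prems by (intro sum_mono mult_left_mono contr pow_nonneg) auto
  also have "\<dots> = c * (\<Sum>l<n. (B ^\<^sub>m k) $$ (i, l) * u l)" by (simp add: sum_distrib_left algebra_simps)
  also have "\<dots> \<le> c * (c ^ k * u i)" using Suc c_nonneg by (intro mult_left_mono) auto
  finally show ?case by simp
qed

lemma pow_entry_le:
  assumes "i < n" "j < n" shows "(B ^\<^sub>m k) $$ (i, j) \<le> c ^ k * (u i / u j)"
proof -
  have "(B ^\<^sub>m k) $$ (i, j) * u j \<le> (\<Sum>j<n. (B ^\<^sub>m k) $$ (i, j) * u j)"
    using assms by (intro member_le_sum) (auto intro!: mult_nonneg_nonneg pow_nonneg less_imp_le[OF weight_pos])
  also have "\<dots> \<le> c ^ k * u i" by (rule pow_weight_le[OF assms(1)])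
  finally show ?thesis using weight_pos[OF assms(2)] by (simp add: field_simps)
qed

lemma summable_pow_entry:
  assumes "i < n" "j < n" shows "summable (\<lambda>k. (B ^\<^sub>m k) $$ (i, j))"
proof (rule summable_comparison_test')
  show "summable (\<lambda>k. c ^ k * (u i / u j))"
    using c_nonneg c_less by (intro summable_mult2 summable_geometric) auto
  show "\<And>k. k \<ge> 0 \<Longrightarrow> norm ((B ^\<^sub>m k) $$ (i, j)) \<le> c ^ k * (u i / u j)"
    using pow_entry_le[OF assms] pow_nonneg[OF assms] by simp
qed

definition neumann :: "real mat" where
  "neumann = mat n n (\<lambda>(i, j). \<Sum>k. (B ^\<^sub>m k) $$ (i, j))"

lemma neumann_carrier [simp]: "neumann \<in> carrier_mat n n"
  by (simp add: neumann_def)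

lemma neumann_dim [simp]: "dim_row neumann = n" "dim_col neumann = n"
  by (simp_all add: neumann_def)

lemma neumann_sums: "i < n \<Longrightarrow> j < n \<Longrightarrow> (\<lambda>k. (B ^\<^sub>m k) $$ (i, j)) sums neumann $$ (i, j)"
  by (simp add: neumann_def summable_sums summable_pow_entry)

lemma neumann_mult_sums:
  assumes X: "X \<in> carrier_mat n m" and ij: "i < n" "j < m"
  shows "(\<lambda>k. (B ^\<^sub>m k * X) $$ (i, j)) sums (neumann * X) $$ (i, j)"
proof -
  have "(\<lambda>k. \<Sum>l<n. (B ^\<^sub>m k) $$ (i, l) * X $$ (l, j)) sums (\<Sum>l<n. neumann $$ (i, l) * X $$ (l, j))"
    using ij by (intro sums_sum sums_mult2 neumann_sums) auto
  then show ?thesis using mat_mult_entry[OF _ X ij] by (simp del: index_mult_mat(1))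
qed

text \<open>Multiplying by \<open>B\<close> drops the first term of the series, and that term is the
  identity.\<close>

lemma neumann_left_inverse: "neumann * (1\<^sub>m n - B) = 1\<^sub>m n"
proof (rule eq_matI)
  fix i j assume "i < dim_row (1\<^sub>m n :: real mat)" "j < dim_col (1\<^sub>m n :: real mat)"
  then have ij: "i < n" "j < n" by auto
  have "(\<lambda>k. (B ^\<^sub>m Suc k) $$ (i, j)) sums (neumann * B) $$ (i, j)"
    using neumann_mult_sums[OF carrier ij] by simp
  moreover have "(\<lambda>k. (B ^\<^sub>m Suc k) $$ (i, j)) sums (neumann $$ (i, j) - (B ^\<^sub>m 0) $$ (i, j))"
    using neumann_sums[OF ij] by (subst sums_Suc_iff) auto
  ultimately have "(neumann * B) $$ (i, j) = neumann $$ (i, j) - 1\<^sub>m n $$ (i, j)"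
    using sums_unique2 carrier by fastforce
  moreover have "neumann * (1\<^sub>m n - B) = neumann - neumann * B"
    using carrier by (subst mult_minus_distrib_mat[of _ n n _ n])
      (auto simp: right_mult_one_mat[OF neumann_carrier])
  ultimately show "(neumann * (1\<^sub>m n - B)) $$ (i, j) = 1\<^sub>m n $$ (i, j)"
    using ij carrier_matD[OF carrier] by (auto simp: carrier_matD[OF neumann_carrier] simp del: index_mult_mat(1))
qed (use carrier in auto)

lemma neumann_right_inverse: "(1\<^sub>m n - B) * neumann = 1\<^sub>m n"
  by (rule mat_mult_left_right_inverse[OF _ _ neumann_left_inverse]) (use carrier in auto)

end

text \<open>\<open>A\<close> is divided by a number \<open>\<tau>\<close> halfway between its
  spectral radius and 1. The quotient still has spectral radius below 1, hence bounded powers, and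
  scaling back gives the decay rate \<open>\<tau>\<close>.\<close>

lemma spectral_radius_less_1_pow_decay:
  fixes A :: "complex mat"
  assumes A: "A \<in> carrier_mat n n" and n: "n > 0" and sr: "spectral_radius A < 1"
  obtains C \<tau> where "0 \<le> \<tau>" "\<tau> < 1"
    "\<And>i j k. i < n \<Longrightarrow> j < n \<Longrightarrow> norm ((A ^\<^sub>m k) $$ (i, j)) \<le> C * \<tau> ^ k"
proof -
  have "spectral_radius A \<ge> 0" using spectral_radius_mem_max(1)[OF A n] by auto
  define \<tau> where "\<tau> = (spectral_radius A + 1) / 2"
  have \<tau>: "0 < \<tau>" "\<tau> < 1" "spectral_radius A < \<tau>"
    using sr \<open>spectral_radius A \<ge> 0\<close> by (auto simp: \<tau>_def)
  let ?B = "complex_of_real (1 / \<tau>) \<cdot>\<^sub>m A"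
  have B: "?B \<in> carrier_mat n n" using A by simp
  obtain e where e: "eigenvalue ?B e" "spectral_radius ?B = norm e"
    using spectral_radius_mem_max(1)[OF B n] by (auto simp: spectrum_def)
  obtain x where x: "x \<in> carrier_vec n" "x \<noteq> 0\<^sub>v n" "?B *\<^sub>v x = e \<cdot>\<^sub>v x"
    using e A by (auto simp: eigenvalue_def eigenvector_def)
  have "A *\<^sub>v x = (complex_of_real \<tau> * e) \<cdot>\<^sub>v x"
  proof -
    have "complex_of_real (1 / \<tau>) \<cdot>\<^sub>v (A *\<^sub>v x) = e \<cdot>\<^sub>v x"
      unfolding x(3)[symmetric] using x(1) A
      by (intro eq_vecI) (auto simp: scalar_prod_def sum_distrib_left algebra_simps)
    then have "complex_of_real \<tau> \<cdot>\<^sub>v (complex_of_real (1 / \<tau>) \<cdot>\<^sub>v (A *\<^sub>v x)) = complex_of_real \<tau> \<cdot>\<^sub>v (e \<cdot>\<^sub>v x)"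
      by simp
    then show ?thesis using \<tau> by (simp add: smult_smult_assoc)
  qed
  then have "eigenvalue A (complex_of_real \<tau> * e)"
    using x A by (auto simp: eigenvalue_def eigenvector_def)
  then have "norm (complex_of_real \<tau> * e) \<le> spectral_radius A"
    by (intro spectral_radius_mem_max(2)[OF A n]) (auto simp: spectrum_def)
  then have "\<tau> * norm e \<le> spectral_radius A" using \<tau> by (simp add: norm_mult)
  then have "\<tau> * norm e < \<tau> * 1" using \<tau> by linarith
  then have "spectral_radius ?B < 1" using \<tau> e by (simp only: mult_less_cancel_left_pos)
  then obtain C where C: "\<And>k. norm_bound (?B ^\<^sub>m k) C"
    using spectral_radius_jnf_norm_bound_less_1_upper_triangular[OF B] by blast
  have pw: "?B ^\<^sub>m k = complex_of_real (1 / \<tau>) ^ k \<cdot>\<^sub>m (A ^\<^sub>m k)" for k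
    by (rule pow_mat_smult[OF A])
  have "norm ((A ^\<^sub>m k) $$ (i, j)) \<le> C * \<tau> ^ k" if "i < n" "j < n" for i j k
  proof -
    have "norm ((?B ^\<^sub>m k) $$ (i, j)) \<le> C" using C[of k] A that by (auto simp: norm_bound_def)
    then have "(1 / \<tau>) ^ k * norm ((A ^\<^sub>m k) $$ (i, j)) \<le> C"
      unfolding pw using that A \<tau> by (simp add: norm_mult norm_power norm_divide)
    then show ?thesis using \<tau> by (simp add: field_simps)
  qed
  then show ?thesis using that[of \<tau> C] \<tau> by auto
qed

text \<open>\<open>v\<close> is the vector of row sums of the Neumann series, that is, the inverse
  of I - B applied to the all-ones vector.\<close>

lemma spectral_radius_less_1_supersolution:
  fixes B :: "real mat"
  assumes B: "B \<in> carrier_mat n n" and n: "n > 0"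
    and nonneg: "\<And>i j. i < n \<Longrightarrow> j < n \<Longrightarrow> B $$ (i, j) \<ge> 0"
    and sr: "spectral_radius (map_mat complex_of_real B) < 1"
  obtains v where "\<And>i. i < n \<Longrightarrow> v i \<ge> 1" "\<And>i. i < n \<Longrightarrow> v i = 1 + (\<Sum>j<n. B $$ (i, j) * v j)"
proof -
  obtain C \<tau> where \<tau>: "0 \<le> \<tau>" "\<tau> < 1"
    "\<And>i j k. i < n \<Longrightarrow> j < n \<Longrightarrow> norm ((map_mat complex_of_real B ^\<^sub>m k) $$ (i, j)) \<le> C * \<tau> ^ k"
    using spectral_radius_less_1_pow_decay[OF _ n sr] B by (metis map_carrier_mat)
  have bd: "\<bar>(B ^\<^sub>m k) $$ (i, j)\<bar> \<le> C * \<tau> ^ k" if "i < n" "j < n" for i j k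
    using \<tau>(3)[OF that, of k] that B by (simp add: map_mat_of_real_pow)
  have sm: "summable (\<lambda>k. (B ^\<^sub>m k) $$ (i, j))" if "i < n" "j < n" for i j
    by (rule summable_comparison_test'[of "\<lambda>k. C * \<tau> ^ k" 0])
      (use bd[OF that] \<tau> in \<open>auto intro!: summable_mult summable_geometric\<close>)
  have pos: "(B ^\<^sub>m k) $$ (i, j) \<ge> 0" if "i < n" "j < n" for i j k
    using abs_pow_mat_le[OF B B, of i j k] nonneg that by simp
  define v where "v i = (\<Sum>j<n. \<Sum>k. (B ^\<^sub>m k) $$ (i, j))" for i
  have v: "v i = 1 + (\<Sum>l<n. B $$ (i, l) * v l)" if i: "i < n" for i
  proof -
    have "(\<Sum>k. (B ^\<^sub>m k) $$ (i, j)) = (if i = j then 1 else 0) + (\<Sum>l<n. B $$ (i, l) * (\<Sum>k. (B ^\<^sub>m k) $$ (l, j)))"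
      if j: "j < n" for j
    proof -
      have "(\<Sum>k. (B ^\<^sub>m k) $$ (i, j)) = (\<Sum>k. (B ^\<^sub>m Suc k) $$ (i, j)) + (B ^\<^sub>m 0) $$ (i, j)"
        using suminf_split_head[OF sm[OF i j]] by simp
      also have "(\<lambda>k. (B ^\<^sub>m Suc k) $$ (i, j)) = (\<lambda>k. \<Sum>l<n. B $$ (i, l) * (B ^\<^sub>m k) $$ (l, j))"
        using B i j by (simp add: pow_mat_commute[OF B] mat_mult_entry[of B n n _ n] del: index_mult_mat(1))
      also have "(\<Sum>k. \<Sum>l<n. B $$ (i, l) * (B ^\<^sub>m k) $$ (l, j)) = (\<Sum>l<n. B $$ (i, l) * (\<Sum>k. (B ^\<^sub>m k) $$ (l, j)))"
        using j by (subst suminf_sum) (auto intro!: summable_mult sm simp: suminf_mult sm)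
      finally show ?thesis using B i j by simp
    qed
    then have "v i = (\<Sum>j<n. (if i = j then 1 else 0) + (\<Sum>l<n. B $$ (i, l) * (\<Sum>k. (B ^\<^sub>m k) $$ (l, j))))"
      by (simp add: v_def)
    also have "\<dots> = 1 + (\<Sum>j<n. \<Sum>l<n. B $$ (i, l) * (\<Sum>k. (B ^\<^sub>m k) $$ (l, j)))"
      using i by (simp add: sum.distrib)
    also have "\<dots> = 1 + (\<Sum>l<n. B $$ (i, l) * v l)"
      by (subst sum.swap) (simp add: v_def sum_distrib_left)
    finally show ?thesis .
  qed
  have v0: "v i \<ge> 0" if "i < n" for i
    using that by (auto simp: v_def intro!: sum_nonneg suminf_nonneg sm pos)
  have "v i \<ge> 1" if "i < n" for i
    using v[OF that] v0 nonneg[OF that] by (auto intro!: sum_nonneg mult_nonneg_nonneg)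
  with v show ?thesis using that by blast
qed

subsection \<open>The non-backtracking edge matrix\<close>

text \<open>The matrix determinant lemma. The block matrix \<open>?X\<close> is reduced in two ways:
  \<open>?L\<close> clears \<open>S\<close> with the identity block and leaves
  \<open>A - S * T\<close>, while \<open>?U\<close> clears it with \<open>A\<close>, whose inverse
  is \<open>Q\<close>. Both multipliers have determinant 1.\<close>

lemma det_minus_mult:
  fixes A Q S T :: "'a :: idom mat"
  assumes A: "A \<in> carrier_mat N N" and Q: "Q \<in> carrier_mat N N"
    and S: "S \<in> carrier_mat N n" and T: "T \<in> carrier_mat n N" and AQ: "A * Q = 1\<^sub>m N"
  shows "det (A - S * T) = det A * det (1\<^sub>m n - T * (Q * S))"
proof -
  let ?X = "four_block_mat (1\<^sub>m n) T S A"
  let ?L = "four_block_mat (1\<^sub>m n) (0\<^sub>m n N) (- S) (1\<^sub>m N)"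
  let ?U = "four_block_mat (1\<^sub>m n) (0\<^sub>m n N) (- (Q * S)) (1\<^sub>m N)"
  have QS: "Q * S \<in> carrier_mat N n" and ST: "S * T \<in> carrier_mat N N" using Q S T by auto
  have TQS: "T * (Q * S) \<in> carrier_mat n n" using T QS by (rule mult_carrier_mat)
  have AST: "A - S * T \<in> carrier_mat N N" by (rule minus_carrier_mat[OF ST])
  have C: "1\<^sub>m n - T * (Q * S) \<in> carrier_mat n n" by (rule minus_carrier_mat[OF TQS])
  have AQS: "A * (Q * S) = S" using assoc_mult_mat[OF A Q S] AQ S by simp
  have X: "?X \<in> carrier_mat (n + N) (n + N)" using A by auto
  have L: "?L \<in> carrier_mat (n + N) (n + N)" and U: "?U \<in> carrier_mat (n + N) (n + N)" by auto
  have detL: "det ?L = 1"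
    using det_four_block_mat_upper_right_zero[OF one_carrier_mat refl uminus_carrier_mat[OF S] one_carrier_mat]
    by simp
  have detU: "det ?U = 1"
    using det_four_block_mat_upper_right_zero[OF one_carrier_mat refl uminus_carrier_mat[OF QS] one_carrier_mat]
    by simp
  have b1: "1\<^sub>m n * 1\<^sub>m n + 0\<^sub>m n N * S = 1\<^sub>m n" and b2: "1\<^sub>m n * T + 0\<^sub>m n N * A = T"
    using A S T by auto
  have b3: "- S * 1\<^sub>m n + 1\<^sub>m N * S = 0\<^sub>m N n" using S by (simp add: uminus_l_inv_mat)
  have "- S * T = - (S * T)" by (rule uminus_mult_left_mat) (use S T in auto)
  moreover have "- X + A = A - X" if "X \<in> carrier_mat N N" for X
    using A that by (intro eq_matI) auto
  ultimately have b4: "- S * T + 1\<^sub>m N * A = A - S * T" using ST A by simp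
  have "?L * ?X = four_block_mat (1\<^sub>m n * 1\<^sub>m n + 0\<^sub>m n N * S) (1\<^sub>m n * T + 0\<^sub>m n N * A)
      (- S * 1\<^sub>m n + 1\<^sub>m N * S) (- S * T + 1\<^sub>m N * A)"
    by (rule mult_four_block_mat) (use A S T in auto)
  then have LX: "?L * ?X = four_block_mat (1\<^sub>m n) T (0\<^sub>m N n) (A - S * T)"
    unfolding b1 b2 b3 b4 .
  have "T * - (Q * S) = - (T * (Q * S))" by (rule uminus_mult_right_mat) (use QS T in auto)
  moreover have "1\<^sub>m n + - X = 1\<^sub>m n - X" if "X \<in> carrier_mat n n" for X :: "'a mat"
    using that by (intro eq_matI) auto
  ultimately have c1: "1\<^sub>m n * 1\<^sub>m n + T * - (Q * S) = 1\<^sub>m n - T * (Q * S)" using TQS by simp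
  have c2: "1\<^sub>m n * 0\<^sub>m n N + T * 1\<^sub>m N = T" and c4: "S * 0\<^sub>m n N + A * 1\<^sub>m N = A" using A S T by auto
  have AQS': "A * - (Q * S) = - S" using uminus_mult_right_mat[of "Q * S" A] QS A AQS by auto
  have "S + - S = 0\<^sub>m N n" using S by (intro eq_matI) auto
  then have c3: "S * 1\<^sub>m n + A * - (Q * S) = 0\<^sub>m N n" unfolding AQS' right_mult_one_mat[OF S] .
  have "?X * ?U = four_block_mat (1\<^sub>m n * 1\<^sub>m n + T * - (Q * S)) (1\<^sub>m n * 0\<^sub>m n N + T * 1\<^sub>m N)
      (S * 1\<^sub>m n + A * - (Q * S)) (S * 0\<^sub>m n N + A * 1\<^sub>m N)"
    by (rule mult_four_block_mat[OF one_carrier_mat T S A one_carrier_mat zero_carrier_mat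
        uminus_carrier_mat[OF QS] one_carrier_mat])
  then have XU: "?X * ?U = four_block_mat (1\<^sub>m n - T * (Q * S)) T (0\<^sub>m N n) A"
    unfolding c1 c2 c3 c4 .
  have "det (A - S * T) = det (?L * ?X)"
    unfolding LX det_four_block_mat_lower_left_zero[OF one_carrier_mat T refl AST] by simp
  also have "\<dots> = det (?X * ?U)"
    unfolding det_mult[OF L X] det_mult[OF X U] detL detU by simp
  also have "\<dots> = det A * det (1\<^sub>m n - T * (Q * S))"
    unfolding XU det_four_block_mat_lower_left_zero[OF C T refl A] by simp
  finally show ?thesis .
qed

text \<open>\<open>Q\<close> and \<open>K\<close> act as inverses of \<open>A\<close> and
  \<open>A - S * T\<close>, each from one side. They satisfy the resolvent identity Q = K - Q S T K;
  multiplying it by \<open>T\<close> on the left and \<open>S\<close> on the right gives the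
  claim.\<close>

lemma woodbury:
  fixes A Q K S T :: "'a :: ring_1 mat"
  assumes A: "A \<in> carrier_mat N N" and Q: "Q \<in> carrier_mat N N" and K: "K \<in> carrier_mat N N"
    and S: "S \<in> carrier_mat N n" and T: "T \<in> carrier_mat n N"
    and QA: "Q * A = 1\<^sub>m N" and K1: "(A - S * T) * K = 1\<^sub>m N"
  shows "(1\<^sub>m n - T * (Q * S)) * (1\<^sub>m n + T * K * S) = 1\<^sub>m n"
proof -
  let ?C = "T * (Q * S)" and ?X = "T * K"
  have C: "?C \<in> carrier_mat n n" and X: "?X \<in> carrier_mat n N" using assms by auto
  have cancel: "1\<^sub>m n - Y + Y = 1\<^sub>m n" if "Y \<in> carrier_mat n n" for Y :: "'a mat"
    using that by (intro eq_matI) auto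
  have "Q = Q * ((A - S * T) * K)" using K1 Q by simp
  also have "\<dots> = Q * (A * K - S * T * K)"
    using assms by (subst minus_mult_distrib_mat[of _ N N]) auto
  also have "\<dots> = Q * (A * K) - Q * (S * T * K)"
    using assms by (intro mult_minus_distrib_mat[of _ N N]) auto
  also have "Q * (A * K) = K" using assoc_mult_mat[OF Q A K] QA K by simp
  also have "Q * (S * T * K) = Q * S * ?X"
    using assoc_mult_mat[OF S T K] assoc_mult_mat[OF Q S X] by simp
  finally have "T * Q = T * (K - Q * S * ?X)" by simp
  also have "\<dots> = ?X - T * (Q * S * ?X)"
    using assms by (intro mult_minus_distrib_mat[of _ n N]) auto
  also have "T * (Q * S * ?X) = ?C * ?X"
    using assms by (intro assoc_mult_mat[symmetric]) auto
  finally have TQ: "T * Q = ?X - ?C * ?X" .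
  have "(1\<^sub>m n - ?C) * (1\<^sub>m n + ?X * S) = (1\<^sub>m n - ?C) * 1\<^sub>m n + (1\<^sub>m n - ?C) * (?X * S)"
    using assms C by (intro mult_add_distrib_mat[of _ n n]) auto
  also have "(1\<^sub>m n - ?C) * 1\<^sub>m n = 1\<^sub>m n - ?C"
    by (rule right_mult_one_mat[of _ n]) (rule minus_carrier_mat[OF C])
  also have "(1\<^sub>m n - ?C) * (?X * S) = (1\<^sub>m n - ?C) * ?X * S"
    using assms C by (intro assoc_mult_mat[symmetric]) auto
  also have "(1\<^sub>m n - ?C) * ?X = ?X - ?C * ?X"
    using X C by (subst minus_mult_distrib_mat[of _ n n]) auto
  also have "(?X - ?C * ?X) * S = ?C" using assoc_mult_mat[OF T Q S] TQ by simp
  also have "1\<^sub>m n - ?C + ?C = 1\<^sub>m n" by (rule cancel[OF C])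
  finally show ?thesis .
qed

section \<open>Directed edges as indices below \<open>n * n\<close>\<close>

lemma edge_index_less:
  assumes "i < n" "j < n" shows "i * n + j < n * (n :: nat)"
proof -
  have "i * n + j < Suc i * n" using assms by simp
  also have "\<dots> \<le> n * n" using assms by (intro mult_right_mono) auto
  finally show ?thesis .
qed

lemma edge_index_div_mod:
  assumes "e < n * (n :: nat)" shows "e div n < n" "e mod n < n"
proof -
  have "n > 0" using assms by (cases n) auto
  then show "e div n < n" "e mod n < n" using assms by (auto simp: less_mult_imp_div_less)
qed

lemma bij_betw_edge_index:
  "bij_betw (\<lambda>(i, j). i * n + j) ({..<n} \<times> {..<n}) {..<n * (n :: nat)}"
  by (rule bij_betw_byWitness[of _ "\<lambda>e. (e div n, e mod n)"])
    (auto simp: edge_index_less edge_index_div_mod)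

lemma sum_edge_index:
  fixes n :: nat shows "(\<Sum>e<n * n. F e) = (\<Sum>i<n. \<Sum>j<n. F (i * n + j))"
  unfolding sum.cartesian_product
  by (subst sum.reindex_bij_betw[OF bij_betw_edge_index, of F n, symmetric]) (simp add: case_prod_unfold)

lemma prod_edge_index:
  fixes n :: nat shows "(\<Prod>e<n * n. F e) = (\<Prod>i<n. \<Prod>j<n. F (i * n + j))"
  unfolding prod.cartesian_product
  by (subst prod.reindex_bij_betw[OF bij_betw_edge_index, of F n, symmetric]) (simp add: case_prod_unfold)

lemma sum_edge_index_head:
  fixes F :: "nat \<Rightarrow> 'a :: comm_monoid_add"
  assumes "i < n"
  shows "(\<Sum>e<n * n. if e mod n = i then F e else 0) = (\<Sum>b<n. F (b * n + i))"
proof -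
  have "(\<Sum>e<n * n. if e mod n = i then F e else 0)
      = (\<Sum>b<n. \<Sum>j<n. if (b * n + j) mod n = i then F (b * n + j) else 0)"
    by (rule sum_edge_index)
  also have "\<dots> = (\<Sum>b<n. \<Sum>j<n. if j = i then F (b * n + j) else 0)"
    by (intro sum.cong) auto
  finally show ?thesis using assms by simp
qed

definition edge_rev :: "nat \<Rightarrow> nat \<Rightarrow> nat" where
  "edge_rev n e = (e mod n) * n + e div n"

lemma edge_rev:
  assumes "e < n * n"
  shows "edge_rev n e < n * n" "edge_rev n e div n = e mod n" "edge_rev n e mod n = e div n"
    "edge_rev n (edge_rev n e) = e"
  using edge_index_div_mod[OF assms] by (auto simp: edge_rev_def edge_index_less)

text \<open>\<open>r\<close> and \<open>a\<close> are kept abstract because the same messages solve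
  the equations for \<open>R\<close> and for its absolute value: only squares of \<open>r\<close>
  enter. In \<open>fixpoint\<close> the excluded neighbour is restored by adding
  \<open>a j i\<close>, so the bracket is the cavity denominator.\<close>

locale bp_fixpoint =
  fixes n :: nat and r a :: "nat \<Rightarrow> nat \<Rightarrow> real"
  assumes sym: "\<And>i j. i < n \<Longrightarrow> j < n \<Longrightarrow> r i j = r j i"
    and diag: "\<And>i. i < n \<Longrightarrow> r i i = 0"
    and fixpoint: "\<And>i j. i < n \<Longrightarrow> j < n \<Longrightarrow> a i j * (1 - (\<Sum>k<n. a k i) + a j i) = (r i j)\<^sup>2"
    and a_nonneg: "\<And>i j. i < n \<Longrightarrow> j < n \<Longrightarrow> a i j \<ge> 0"
    and sum_a_less: "\<And>i. i < n \<Longrightarrow> (\<Sum>k<n. a k i) < 1"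
begin

definition node :: "nat \<Rightarrow> real" where "node i = 1 - (\<Sum>k<n. a k i)"
definition cavity :: "nat \<Rightarrow> nat \<Rightarrow> real" where "cavity i j = node i + a j i"
definition w :: "nat \<Rightarrow> nat \<Rightarrow> real" where "w i j = r i j / cavity i j"
definition z :: "nat \<Rightarrow> real" where "z i = 1 / node i"

lemma node_pos: "i < n \<Longrightarrow> node i > 0" using sum_a_less[of i] by (simp add: node_def)
lemma z_ge_1: "i < n \<Longrightarrow> z i \<ge> 1"
  using node_pos[of i] a_nonneg by (auto simp: z_def node_def intro!: sum_nonneg)
lemma cavity_pos: "i < n \<Longrightarrow> j < n \<Longrightarrow> cavity i j > 0"
  using node_pos[of i] a_nonneg[of j i] by (simp add: cavity_def)

lemma a_eq: "i < n \<Longrightarrow> j < n \<Longrightarrow> a i j = r i j * w i j"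
  using fixpoint[of i j] cavity_pos[of i j]
  by (simp add: w_def field_simps cavity_def node_def power2_eq_square)

lemma w_diag: "i < n \<Longrightarrow> w i i = 0" by (simp add: w_def diag)

text \<open>The quotient turns out to be the correction that an edge contributes to
  \<open>Z_bp\<close>. It is also the determinant of the block of \<open>1 + Pm\<close> on an edge
  and its reversal.\<close>

lemma one_minus_ww:
  assumes ij: "i < n" "j < n" shows "1 - w i j * w j i = node i / cavity i j"
proof -
  have "w i j * w j i = a j i / cavity i j"
    using a_eq[OF ij(2,1)] sym[OF ij] by (simp add: w_def)
  then show ?thesis using cavity_pos[OF ij] by (simp add: field_simps cavity_def)
qed

lemma one_minus_ww_pos: "i < n \<Longrightarrow> j < n \<Longrightarrow> 1 - w i j * w j i > 0"
  by (simp add: one_minus_ww node_pos cavity_pos)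

text \<open>Dividing by the block determinant exchanges the cavity denominator for the node
  denominator, which is how vertex quantities come out of edge matrices.\<close>

lemma w_over: "i < n \<Longrightarrow> j < n \<Longrightarrow> w i j / (1 - w i j * w j i) = r i j * z i"
  using cavity_pos[of i j] node_pos[of i] unfolding one_minus_ww by (simp add: w_def z_def)

abbreviation "we e \<equiv> w (e div n) (e mod n)"

section \<open>Edge matrices and their determinant identity\<close>

definition Rm :: "real mat" where "Rm = mat n n (\<lambda>(i, j). r i j)"
definition Zm :: "real mat" where "Zm = mat n n (\<lambda>(i, j). if i = j then z i else 0)"
text \<open>The directed edge from \<open>i\<close> to \<open>j\<close> is encoded as the index \<open>i * n + j\<close>; all pairs are indexed, non-edges
  having weight 0. Row \<open>e\<close> of \<open>Mm\<close> is supported on the edges preceding \<open>e\<close>, so powers of \<open>Mm\<close> read walks backwards.\<close>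
definition Mm :: "real mat" where
  "Mm = mat (n * n) (n * n) (\<lambda>(e, f). if f mod n = e div n \<and> f div n \<noteq> e mod n then we e else 0)"
text \<open>\<open>Sm * Tm\<close> joins \<open>e\<close> to every edge ending at its tail, its own
  reversal included, and \<open>Pm\<close> is exactly that reversal part. Hence \<open>Mm\<close> is
  \<open>Sm * Tm - Pm\<close>, a matrix of rank at most \<open>n\<close> corrected by small
  blocks.\<close>

definition Sm :: "real mat" where
  "Sm = mat (n * n) n (\<lambda>(e, i). if e div n = i then we e else 0)"
definition Tm :: "real mat" where
  "Tm = mat n (n * n) (\<lambda>(i, f). if f mod n = i then 1 else 0)"
definition Pm :: "real mat" where
  "Pm = mat (n * n) (n * n) (\<lambda>(e, f). if f = edge_rev n e then we e else 0)"
text \<open>\<open>1 + Pm\<close> splits into 2 by 2 blocks, one for each pair of opposite edges,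
  and \<open>Qm\<close> inverts them. A loop index is its own reversal but has weight 0.\<close>

definition Qm :: "real mat" where
  "Qm = mat (n * n) (n * n) (\<lambda>(e, f). ((if f = e then 1 else 0) - (if f = edge_rev n e then we e else 0))
     / (1 - we e * we (edge_rev n e)))"

lemma carriers [simp]:
  "Rm \<in> carrier_mat n n" "Zm \<in> carrier_mat n n" "Mm \<in> carrier_mat (n * n) (n * n)"
  "Sm \<in> carrier_mat (n * n) n" "Tm \<in> carrier_mat n (n * n)" "Pm \<in> carrier_mat (n * n) (n * n)"
  "Qm \<in> carrier_mat (n * n) (n * n)"
  by (simp_all add: Rm_def Zm_def Mm_def Sm_def Tm_def Pm_def Qm_def)

lemma dims [simp]:
  "dim_row Rm = n" "dim_col Rm = n" "dim_row Zm = n" "dim_col Zm = n"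
  "dim_row Mm = n * n" "dim_col Mm = n * n" "dim_row Sm = n * n" "dim_col Sm = n"
  "dim_row Tm = n" "dim_col Tm = n * n" "dim_row Pm = n * n" "dim_col Pm = n * n"
  "dim_row Qm = n * n" "dim_col Qm = n * n"
  by (simp_all add: Rm_def Zm_def Mm_def Sm_def Tm_def Pm_def Qm_def)

lemma Pm_mult_entry:
  assumes X: "X \<in> carrier_mat (n * n) m" and e: "e < n * n" "f < m"
  shows "(Pm * X) $$ (e, f) = we e * X $$ (edge_rev n e, f)"
proof -
  have "(Pm * X) $$ (e, f) = (\<Sum>g<n * n. if g = edge_rev n e then we e * X $$ (g, f) else 0)"
    unfolding mat_mult_entry[OF carriers(6) X e] by (intro sum.cong) (use e in \<open>auto simp: Pm_def\<close>)
  then show ?thesis using edge_rev(1)[OF e(1)] by simp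
qed

lemma Qm_mult_entry:
  assumes X: "X \<in> carrier_mat (n * n) m" and e: "e < n * n" "f < m"
  shows "(Qm * X) $$ (e, f) = (X $$ (e, f) - we e * X $$ (edge_rev n e, f)) / (1 - we e * we (edge_rev n e))"
proof -
  have "(Qm * X) $$ (e, f) = (\<Sum>g<n * n. ((if g = e then X $$ (g, f) else 0)
      - (if g = edge_rev n e then we e * X $$ (g, f) else 0)) / (1 - we e * we (edge_rev n e)))"
    unfolding mat_mult_entry[OF carriers(7) X e] by (intro sum.cong) (use e in \<open>auto simp: Qm_def algebra_simps\<close>)
  then show ?thesis using edge_rev(1)[OF e(1)] e
    by (simp add: sum_divide_distrib[symmetric] sum_subtractf)
qed

lemma one_plus_Pm_mult_Qm: "(1\<^sub>m (n * n) + Pm) * Qm = 1\<^sub>m (n * n)"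
proof -
  have "(1\<^sub>m (n * n) + Pm) * Qm = Qm + Pm * Qm"
    using add_mult_distrib_mat[of "1\<^sub>m (n * n)" "n * n" "n * n" Pm Qm "n * n"] by simp
  also have "\<dots> = 1\<^sub>m (n * n)"
  proof (rule eq_matI)
    fix e f assume "e < dim_row (1\<^sub>m (n * n) :: real mat)" "f < dim_col (1\<^sub>m (n * n) :: real mat)"
    then have ef: "e < n * n" "f < n * n" by auto
    note d = edge_index_div_mod[OF ef(1)] and rv = edge_rev[OF ef(1)]
    have "1 - we e * we (edge_rev n e) > 0" using one_minus_ww_pos[OF d] by (simp add: rv)
    then show "(Qm + Pm * Qm) $$ (e, f) = 1\<^sub>m (n * n) $$ (e, f)"
      using ef Pm_mult_entry[OF carriers(7) ef] rv
      by (auto simp: Qm_def field_simps simp del: index_mult_mat(1))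
  qed simp_all
  finally show ?thesis .
qed

lemma Qm_mult_one_plus_Pm: "Qm * (1\<^sub>m (n * n) + Pm) = 1\<^sub>m (n * n)"
  by (rule mat_mult_left_right_inverse[OF _ _ one_plus_Pm_mult_Qm]) auto

lemma Sm_mult_entry:
  assumes X: "X \<in> carrier_mat n m" and e: "e < n * n" "f < m"
  shows "(Sm * X) $$ (e, f) = we e * X $$ (e div n, f)"
proof -
  have "(Sm * X) $$ (e, f) = (\<Sum>i<n. if i = e div n then we e * X $$ (i, f) else 0)"
    unfolding mat_mult_entry[OF carriers(4) X e] by (intro sum.cong) (use e in \<open>auto simp: Sm_def\<close>)
  then show ?thesis using edge_index_div_mod[OF e(1)] by simp
qed

lemma one_minus_Mm: "1\<^sub>m (n * n) - Mm = (1\<^sub>m (n * n) + Pm) - Sm * Tm"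
proof (rule eq_matI)
  fix e f assume "e < dim_row ((1\<^sub>m (n * n) + Pm) - Sm * Tm)" "f < dim_col ((1\<^sub>m (n * n) + Pm) - Sm * Tm)"
  then have ef: "e < n * n" "f < n * n" by auto
  have "f = edge_rev n e \<longleftrightarrow> f mod n = e div n \<and> f div n = e mod n"
    using edge_rev[OF ef(1)] by (metis div_mult_mod_eq)
  then show "(1\<^sub>m (n * n) - Mm) $$ (e, f) = ((1\<^sub>m (n * n) + Pm) - Sm * Tm) $$ (e, f)"
    using ef Sm_mult_entry[OF carriers(5) ef] edge_index_div_mod[OF ef(1)]
    by (auto simp: Mm_def Pm_def Tm_def simp del: index_mult_mat(1))
qed auto

text \<open>\<open>Tm\<close> adds up the edges entering a vertex. In \<open>Qm * Sm\<close> an edge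
  contributes \<open>r i j * z i\<close> off the diagonal, and its reversal contributes a message on
  the diagonal; these messages sum to \<open>z j - 1\<close>, which leaves \<open>z j\<close>
  there.\<close>

lemma Tm_Qm_Sm: "1\<^sub>m n - Tm * (Qm * Sm) = (1\<^sub>m n - Rm) * Zm"
proof (rule eq_matI)
  fix j i assume "j < dim_row ((1\<^sub>m n - Rm) * Zm)" "i < dim_col ((1\<^sub>m n - Rm) * Zm)"
  then have ij: "j < n" "i < n" by auto
  have QS: "Qm * Sm \<in> carrier_mat (n * n) n" by (rule mult_carrier_mat[OF carriers(7,4)])
  have qs: "(Qm * Sm) $$ (b * n + j, i) = (if b = i then r i j * z i else 0) - (if i = j then z j * a b j else 0)"
    if b: "b < n" for b
  proof -
    have e: "b * n + j < n * n" using b ij by (rule_tac edge_index_less)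
    have dv: "(b * n + j) div n = b" "(b * n + j) mod n = j" using ij by auto
    have "(Qm * Sm) $$ (b * n + j, i) = ((if b = i then w b j else 0) - w b j * (if j = i then w j b else 0)) / (1 - w b j * w j b)"
    proof -
      have "Sm $$ (b * n + j, i) = (if b = i then w b j else 0)"
        using e ij(2) unfolding Sm_def by (subst index_mat) (simp_all only: dv split)
      moreover have "Sm $$ (edge_rev n (b * n + j), i) = (if j = i then w j b else 0)"
        using edge_rev(1)[OF e] ij(2) unfolding Sm_def
        by (subst index_mat) (simp_all only: edge_rev(2,3)[OF e] dv split)
      ultimately show ?thesis
        unfolding Qm_mult_entry[OF carriers(4) e ij(2)] edge_rev(2,3)[OF e] dv by simp
    qed
    also have "\<dots> = (if b = i then w b j / (1 - w b j * w j b) else 0) - (if j = i then w j b * (w b j / (1 - w b j * w j b)) else 0)"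
      by (simp add: diff_divide_distrib)
    also have "w j b * (w b j / (1 - w b j * w j b)) = w b j * (w j b / (1 - w j b * w b j))"
      by (simp add: mult.commute)
    also have "\<dots> = z j * a b j" using w_over[OF ij(1) b] a_eq[OF b ij(1)] sym[OF b ij(1)] by simp
    finally show ?thesis using w_over[OF b ij(1)] by auto
  qed
  have "(Tm * (Qm * Sm)) $$ (j, i) = (\<Sum>e<n * n. if e mod n = j then (Qm * Sm) $$ (e, i) else 0)"
    unfolding mat_mult_entry[OF carriers(5) QS ij] by (intro sum.cong) (use ij in \<open>auto simp: Tm_def\<close>)
  also have "\<dots> = (\<Sum>b<n. (Qm * Sm) $$ (b * n + j, i))" by (rule sum_edge_index_head[OF ij(1)])
  also have "\<dots> = (\<Sum>b<n. (if b = i then r i j * z i else 0) - (if i = j then z j * a b j else 0))"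
    by (intro sum.cong) (auto simp: qs simp del: index_mult_mat(1))
  also have "\<dots> = r i j * z i - (if i = j then z j * (\<Sum>b<n. a b j) else 0)"
    using ij by (simp add: sum_subtractf sum_distrib_left)
  also have "z j * (\<Sum>b<n. a b j) = z j - 1" using node_pos[OF ij(1)] by (simp add: z_def node_def field_simps)
  finally have L: "(Tm * (Qm * Sm)) $$ (j, i) = r i j * z i - (if i = j then z j - 1 else 0)" .
  have "((1\<^sub>m n - Rm) * Zm) $$ (j, i) = (\<Sum>k<n. if k = i then (1\<^sub>m n - Rm) $$ (j, k) * z i else 0)"
    unfolding mat_mult_entry[OF minus_carrier_mat[OF carriers(1)] carriers(2) ij]
    by (intro sum.cong) (use ij in \<open>auto simp: Zm_def\<close>)
  then have "((1\<^sub>m n - Rm) * Zm) $$ (j, i) = (1\<^sub>m n - Rm) $$ (j, i) * z i"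
    using ij by simp
  then show "(1\<^sub>m n - Tm * (Qm * Sm)) $$ (j, i) = ((1\<^sub>m n - Rm) * Zm) $$ (j, i)"
    using ij L sym[OF ij] diag by (auto simp: Rm_def algebra_simps simp del: index_mult_mat(1))
qed auto

text \<open>All blocks are eliminated simultaneously: the unit lower triangular \<open>?L\<close>
  clears the entry below the diagonal in each block and leaves the pivots
  \<open>1 - w i j * w j i\<close>.\<close>

lemma det_one_plus_Pm:
  "det (1\<^sub>m (n * n) + Pm) = (\<Prod>i<n. \<Prod>j<n. if i < j then 1 - w i j * w j i else 1)"
proof -
  define D where "D = mat (n * n) (n * n) (\<lambda>(e, f). if e mod n < e div n \<and> f = edge_rev n e then we e else 0)"
  let ?L = "1\<^sub>m (n * n) - D"
  let ?X = "(1\<^sub>m (n * n) + Pm) * ?L"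
  have D: "D \<in> carrier_mat (n * n) (n * n)" by (simp add: D_def)
  then have L: "?L \<in> carrier_mat (n * n) (n * n)" by (intro minus_carrier_mat)
  have lt: "edge_rev n e < e" if "e < n * n" "e mod n < e div n" for e
  proof -
    have "edge_rev n e < Suc (e mod n) * n"
      using edge_index_div_mod[OF that(1)] by (simp add: edge_rev_def)
    also have "\<dots> \<le> (e div n) * n" using that by (intro mult_right_mono) auto
    also have "\<dots> \<le> e" by simp
    finally show ?thesis .
  qed
  have eq: "e mod n = e div n" if "e < n * n" "edge_rev n e = e" for e
    using edge_rev(2)[OF that(1)] that by simp
  have we0: "we e = 0" if "e < n * n" "e mod n = e div n" for e
    using that edge_index_div_mod[OF that(1)] by (simp add: w_diag)
  have "?L $$ (e, f) = (if e = f then 1 else 0)" if "e \<le> f" "f < n * n" for e f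
    using lt[of e] that by (auto simp: D_def)
  then have detL: "det ?L = 1"
    using D by (subst det_lower_triangular[of "n * n"])
      (auto simp: prod_list_diag_prod intro!: prod.neutral minus_carrier_mat)
  have "?X = ?L + Pm * ?L"
    using L by (subst add_mult_distrib_mat[of _ "n * n" "n * n"]) auto
  then have X: "?X $$ (e, f) = (if e = f then 1 - (if e div n < e mod n then we e * we (edge_rev n e) else 0) else 0)
      + (if f = edge_rev n e \<and> e div n < e mod n then we e else 0)" if ef: "e < n * n" "f < n * n" for e f
    using ef Pm_mult_entry[OF L ef] edge_rev[OF ef(1)] D eq[OF ef(1)] we0[OF ef(1)]
    by (cases "e mod n = e div n") (auto simp: D_def simp del: index_mult_mat(1))
  have "det ?X = (\<Prod>e<n * n. if e div n < e mod n then 1 - we e * we (edge_rev n e) else 1)"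
  proof (subst det_upper_triangular[of _ "n * n"])
    show "?X \<in> carrier_mat (n * n) (n * n)" using L by (intro mult_carrier_mat[of _ _ "n * n"]) auto
    have "\<not> f < e" if "e < n * n" "f = edge_rev n e" "e div n < e mod n" for e f
      using lt[of f] edge_rev[OF that(1)] that by auto
    then show "upper_triangular ?X"
      using D by (intro upper_triangularI) (auto simp: X simp del: index_mult_mat(1))
    show "prod_list (diag_mat ?X) = (\<Prod>e<n * n. if e div n < e mod n then 1 - we e * we (edge_rev n e) else 1)"
      unfolding prod_list_diag_prod
      by (rule prod.cong) (use D in \<open>auto simp: X atLeast0LessThan simp del: index_mult_mat(1) dest: eq\<close>)
  qed
  also have "\<dots> = (\<Prod>i<n. \<Prod>j<n. if i < j then 1 - w i j * w j i else 1)"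
    unfolding prod_edge_index by (intro prod.cong refl) (simp add: edge_rev(2,3) edge_index_less)
  finally show ?thesis using detL det_mult[of "1\<^sub>m (n * n) + Pm" "n * n" ?L] L by simp
qed

text \<open>\<open>det_minus_mult\<close> passes from dimension \<open>n * n\<close> to dimension
  \<open>n\<close>; for the messages of \<open>R\<close> the first two products together are
  \<open>Z_bp\<close>.\<close>

theorem det_one_minus_Mm:
  "det (1\<^sub>m (n * n) - Mm) =
    (\<Prod>i<n. \<Prod>j<n. if i < j then 1 - w i j * w j i else 1) * (\<Prod>i<n. z i) * det (1\<^sub>m n - Rm)"
proof -
  have "det Zm = (\<Prod>i<n. z i)"
    by (subst det_upper_triangular[of Zm n]) (auto simp: Zm_def prod_list_diag_prod atLeast0LessThan)
  moreover have "det ((1\<^sub>m n - Rm) * Zm) = det (1\<^sub>m n - Rm) * det Zm"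
    by (rule det_mult[of _ n]) (auto intro!: minus_carrier_mat)
  ultimately show ?thesis
    unfolding one_minus_Mm using det_minus_mult[OF _ _ carriers(4,5) one_plus_Pm_mult_Qm]
    by (simp add: Tm_Qm_Sm det_one_plus_Pm)
qed

end

subsection \<open>Nonnegative weights and closed non-backtracking walks\<close>

text \<open>A shortest return \<open>x a = x (a + l)\<close> is a cycle: minimality forbids other
  repetitions, length 1 would be a loop and length 2 a reversal. The turn at the base point may
  backtrack, as it can when a walk is closed by \<open>Wm\<close>.\<close>

lemma nonbacktracking_imp_cycle:
  fixes x :: "nat \<Rightarrow> 'a"
  assumes m: "m > 0" and closed: "x m = x 0"
    and edge: "\<And>i. i < m \<Longrightarrow> E (x i) (x (Suc i))"
    and nb: "\<And>i. i + 2 \<le> m \<Longrightarrow> x i \<noteq> x (i + 2)"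
    and irrefl: "\<And>y. \<not> E y y"
  obtains l y where "3 \<le> l" "l \<le> m" "inj_on y {..<l}" "\<And>i. i < l \<Longrightarrow> E (y i) (y (Suc i mod l))"
proof -
  let ?P = "\<lambda>l. l > 0 \<and> (\<exists>a. a + l \<le> m \<and> x a = x (a + l))"
  define l where "l = (LEAST l. ?P l)"
  have Pm: "?P m" using m closed by (auto intro!: exI[of _ 0])
  then have Pl: "?P l" unfolding l_def by (rule LeastI)
  have lm: "l \<le> m" unfolding l_def using Pm by (rule Least_le)
  have min: "\<not> ?P l'" if "l' < l" for l' using that unfolding l_def by (rule not_less_Least)
  from Pl obtain a where a: "l > 0" "a + l \<le> m" "x a = x (a + l)" by blast
  have "l \<noteq> 1" using edge[of a] a irrefl by auto
  moreover have "l \<noteq> 2" using nb[of a] a by auto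
  ultimately have "3 \<le> l" using a(1) by linarith
  moreover have "inj_on (\<lambda>i. x (a + i)) {..<l}"
  proof (rule inj_onI)
    fix i j assume ij: "i \<in> {..<l}" "j \<in> {..<l}" "x (a + i) = x (a + j)"
    have False if "i < j" "j < l" "x (a + i) = x (a + j)" for i j
    proof -
      have "?P (j - i)" using that a by (intro conjI exI[of _ "a + i"]) auto
      moreover have "j - i < l" using that by simp
      ultimately show False using min by blast
    qed
    then show "i = j" using ij by (metis lessThan_iff linorder_neqE_nat)
  qed
  moreover have "E (x (a + i)) (x (a + Suc i mod l))" if "i < l" for i
  proof (cases "Suc i = l")
    case True
    then show ?thesis using edge[of "a + i"] a by auto
  next
    case False
    then show ?thesis using edge[of "a + i"] a that by auto
  qed
  ultimately show ?thesis using that[of l "\<lambda>i. x (a + i)"] lm by blast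
qed

lemma pow_mat_nonzero_walk:
  fixes A :: "real mat"
  assumes A: "A \<in> carrier_mat n n" and "i < n" "j < n" "(A ^\<^sub>m k) $$ (i, j) \<noteq> 0"
  shows "\<exists>p. p 0 = i \<and> p k = j \<and> (\<forall>l<k. A $$ (p l, p (Suc l)) \<noteq> 0) \<and> (\<forall>l\<le>k. p l < n)"
  using assms(3,4)
proof (induction k arbitrary: j)
  case 0
  then show ?case using A assms(2) by (intro exI[of _ "\<lambda>_. i"]) (auto split: if_splits)
next
  case (Suc k)
  have "(\<Sum>l<n. (A ^\<^sub>m k) $$ (i, l) * A $$ (l, j)) \<noteq> 0"
    using mat_mult_entry[of "A ^\<^sub>m k" n n A n i j] A assms(2) Suc.prems by (simp del: index_mult_mat(1))
  then obtain l where l: "l < n" "(A ^\<^sub>m k) $$ (i, l) \<noteq> 0" "A $$ (l, j) \<noteq> 0"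
    using sum.not_neutral_contains_not_neutral by (metis (no_types, lifting) lessThan_iff mult_eq_0_iff)
  from Suc.IH[OF l(1,2)] obtain p where p: "p 0 = i" "p k = l" "\<forall>l<k. A $$ (p l, p (Suc l)) \<noteq> 0"
    "\<forall>l\<le>k. p l < n" by blast
  show ?case
    by (rule exI[of _ "\<lambda>m. if m = Suc k then j else p m"]) (use p l Suc.prems in \<open>auto simp: less_Suc_eq\<close>)
qed

text \<open>The vector \<open>v\<close> is a supersolution with slack at least 1 at every vertex,
  and \<open>a_le\<close> makes the edge weight \<open>u0\<close> nonnegative.\<close>

locale bp_supersolution = bp_fixpoint +
  fixes v :: "nat \<Rightarrow> real"
  assumes r_nonneg: "\<And>i j. i < n \<Longrightarrow> j < n \<Longrightarrow> r i j \<ge> 0"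
    and v_pos: "\<And>i. i < n \<Longrightarrow> v i > 0"
    and super: "\<And>i. i < n \<Longrightarrow> 1 + (\<Sum>j<n. r i j * v j) \<le> v i"
    and a_le: "\<And>i j. i < n \<Longrightarrow> j < n \<Longrightarrow> a i j * v j \<le> r i j * v i"
begin

lemma w_nonneg: "i < n \<Longrightarrow> j < n \<Longrightarrow> w i j \<ge> 0"
  using r_nonneg[of i j] cavity_pos[of i j] by (simp add: w_def)

definition u0 :: "nat \<Rightarrow> nat \<Rightarrow> real" where "u0 i j = r i j * v i - a i j * v j"

text \<open>The two \<open>u0\<close> terms on the right, times \<open>w j i\<close>, are row (j, i)
  of \<open>Mm\<close> applied to \<open>u0\<close>. So \<open>u0\<close> exceeds its image under
  \<open>Mm\<close> by \<open>w j i\<close> times the slack of \<open>v\<close> at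
  \<open>j\<close>.\<close>

lemma u0_eq:
  assumes ij: "i < n" "j < n"
  shows "u0 j i = w j i * (v j - (\<Sum>k<n. r j k * v k) + (\<Sum>k<n. u0 k j) - u0 i j)"
proof -
  have "(\<Sum>k<n. u0 k j) = (\<Sum>k<n. r j k * v k) - (\<Sum>k<n. a k j) * v j"
    using ij sym by (simp add: u0_def sum_subtractf sum_distrib_right)
  then have "v j - (\<Sum>k<n. r j k * v k) + (\<Sum>k<n. u0 k j) - u0 i j = v j * cavity j i - r i j * v i"
    by (simp add: u0_def cavity_def node_def algebra_simps)
  moreover have "w j i * (v j * cavity j i - r i j * v i) = u0 j i"
    using cavity_pos[OF ij(2,1)] a_eq[OF ij(2,1)] sym[OF ij]
    by (simp add: u0_def w_def field_simps)
  ultimately show ?thesis by simp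
qed

lemma u0_nonneg: "i < n \<Longrightarrow> j < n \<Longrightarrow> u0 i j \<ge> 0"
  using a_le by (simp add: u0_def)

text \<open>On edges this is the superharmonic weight \<open>u0\<close>, for which \<open>M u < u\<close> with slack \<open>w j i\<close> times at least 1;
  the small value on non-edges only makes the weight positive.\<close>
definition u :: "nat \<Rightarrow> real" where
  "u e = (if r (e div n) (e mod n) = 0 then 1 / (n + 1) else u0 (e div n) (e mod n))"

lemma u0_sum_gt:
  assumes ij: "i < n" "j < n" and "r j i \<noteq> 0"
  shows "w j i * (\<Sum>b<n. if b \<noteq> i then u (b * n + j) else 0) < u0 j i"
proof -
  \<comment> \<open>At most \<open>n\<close> non-edges, each of weight \<open>1 / (n + 1)\<close>,
    add less than 1 in total, which the slack of \<open>v\<close> absorbs.\<close>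
  have "(\<Sum>b<n. if b \<noteq> i then u (b * n + j) else 0) \<le> (\<Sum>b<n. 1 / (n + 1) + (u0 b j - (if b = i then u0 b j else 0)))"
    using u0_nonneg ij by (intro sum_mono) (auto simp: u_def)
  also have "\<dots> = n / (n + 1) + ((\<Sum>b<n. u0 b j) - u0 i j)"
    using ij by (simp add: sum.distrib sum_subtractf)
  also have "\<dots> < 1 + ((\<Sum>b<n. u0 b j) - u0 i j)" by simp
  also have "\<dots> \<le> v j - (\<Sum>k<n. r j k * v k) + (\<Sum>k<n. u0 k j) - u0 i j"
    using super[OF ij(2)] by simp
  finally show ?thesis
    unfolding u0_eq[OF ij]
    using r_nonneg[OF ij(2,1)] cavity_pos[OF ij(2,1)] assms(3)
    by (intro mult_strict_left_mono) (auto simp: w_def)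
qed

lemma Mm_entry: "e < n * n \<Longrightarrow> f < n * n \<Longrightarrow>
    Mm $$ (e, f) = (if f mod n = e div n \<and> f div n \<noteq> e mod n then we e else 0)"
  by (simp add: Mm_def)

lemma u_pos: assumes "e < n * n" shows "u e > 0"
proof -
  note d = edge_index_div_mod[OF assms]
  have "0 \<le> w (e div n) (e mod n) * (\<Sum>b<n. if b \<noteq> e mod n then u (b * n + e div n) else 0)"
    using d u0_nonneg w_nonneg by (intro mult_nonneg_nonneg sum_nonneg) (auto simp: u_def)
  then show ?thesis using u0_sum_gt[OF d(2,1)] by (auto simp: u_def)
qed

lemma Mm_nonneg: "e < n * n \<Longrightarrow> f < n * n \<Longrightarrow> Mm $$ (e, f) \<ge> 0"
  by (simp add: Mm_entry w_nonneg edge_index_div_mod)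

lemma Mm_u_less:
  assumes e: "e < n * n" shows "(\<Sum>f<n * n. Mm $$ (e, f) * u f) < u e"
proof -
  note d = edge_index_div_mod[OF e]
  have "(\<Sum>f<n * n. Mm $$ (e, f) * u f)
      = (\<Sum>f<n * n. if f mod n = e div n then (if f div n \<noteq> e mod n then we e * u f else 0) else 0)"
    by (intro sum.cong) (auto simp: Mm_entry e)
  also have "\<dots> = (\<Sum>b<n. if (b * n + e div n) div n \<noteq> e mod n then we e * u (b * n + e div n) else 0)"
    by (rule sum_edge_index_head[OF d(1)])
  also have "\<dots> = we e * (\<Sum>b<n. if b \<noteq> e mod n then u (b * n + e div n) else 0)"
    unfolding sum_distrib_left using d by (intro sum.cong) auto
  also have "\<dots> < u e"
    using u0_sum_gt[OF d(2,1)] u_pos[OF e] by (cases "r (e div n) (e mod n) = 0") (auto simp: u_def w_def)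
  finally show ?thesis .
qed

lemma Mm_contraction: obtains c where "weighted_contraction (n * n) Mm u c"
proof -
  obtain c where "0 \<le> c" "c < 1" "\<And>e. e < n * n \<Longrightarrow> (\<Sum>f<n * n. Mm $$ (e, f) * u f) \<le> c * u e"
    by (rule strict_weight_imp_contraction[of "n * n" u "\<lambda>e f. Mm $$ (e, f)"]) (simp_all only: u_pos Mm_u_less)
  then have "weighted_contraction (n * n) Mm u c"
    by unfold_locales (auto simp: u_pos Mm_nonneg)
  then show ?thesis using that by blast
qed

lemma Rm_contraction: obtains c where "weighted_contraction n Rm v c"
proof -
  have "(\<Sum>j<n. r i j * v j) < v i" if "i < n" for i using super[OF that] by simp
  then obtain c where "0 \<le> c" "c < 1" "\<And>i. i < n \<Longrightarrow> (\<Sum>j<n. r i j * v j) \<le> c * v i"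
    using v_pos strict_weight_imp_contraction[of n v r thesis for thesis] by blast
  then have "weighted_contraction n Rm v c"
    by unfold_locales (auto simp: v_pos r_nonneg Rm_def)
  then show ?thesis using that by blast
qed

text \<open>The closing step of a closed walk, equal to \<open>Sm * (Zm * Tm)\<close>. It dominates
  \<open>Mm\<close> because \<open>z\<close> is at least 1 and because it permits
  backtracking.\<close>

definition Wm :: "real mat" where
  "Wm = mat (n * n) (n * n) (\<lambda>(f, e). if e mod n = f div n then we f * z (f div n) else 0)"

lemma Wm_carrier [simp]: "Wm \<in> carrier_mat (n * n) (n * n)" "dim_row Wm = n * n" "dim_col Wm = n * n"
  by (simp_all add: Wm_def)

lemma Wm_eq: "Sm * (Zm * Tm) = Wm"
proof (rule eq_matI)
  fix f e assume "f < dim_row Wm" "e < dim_col Wm"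
  then have fe: "f < n * n" "e < n * n" by auto
  note d = edge_index_div_mod[OF fe(1)]
  have ZT: "Zm * Tm \<in> carrier_mat n (n * n)" by (rule mult_carrier_mat[OF carriers(2,5)])
  have "(Zm * Tm) $$ (f div n, e) = (\<Sum>i<n. if i = f div n then z i * Tm $$ (i, e) else 0)"
    unfolding mat_mult_entry[OF carriers(2,5) d(1) fe(2)]
    by (intro sum.cong) (use d in \<open>auto simp: Zm_def\<close>)
  then have "(Zm * Tm) $$ (f div n, e) = z (f div n) * (if e mod n = f div n then 1 else 0)"
    using d fe by (simp add: Tm_def)
  then show "(Sm * (Zm * Tm)) $$ (f, e) = Wm $$ (f, e)"
    unfolding Sm_mult_entry[OF ZT fe] using fe by (simp add: Wm_def del: index_mult_mat(1))
qed auto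

lemma Mm_le_Wm: assumes "e < n * n" "f < n * n" shows "Mm $$ (e, f) \<le> Wm $$ (e, f)"
proof -
  note d = edge_index_div_mod[OF assms(1)]
  have "we e * 1 \<le> we e * z (e div n)" using d by (intro mult_left_mono z_ge_1 w_nonneg)
  then show ?thesis using assms w_nonneg[OF d] by (auto simp: Mm_entry Wm_def)
qed

text \<open>With K the inverse of I - Mm, \<open>woodbury\<close> and \<open>Tm_Qm_Sm\<close> show
  that the inverse of I - Rm is Zm + Zm Tm K Sm. Taking traces and moving \<open>Zm * Tm\<close>
  cyclically to the end leaves the trace of K Wm; both inverses are expanded as Neumann
  series.\<close>

lemma trace_gap_sums:
  "summable (\<lambda>k. mat_trace (Rm ^\<^sub>m k))"
  "(\<lambda>k. mat_trace (Mm ^\<^sub>m k * Wm)) sums ((\<Sum>k. mat_trace (Rm ^\<^sub>m k)) - (\<Sum>i<n. z i))"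
proof -
  obtain c where "weighted_contraction (n * n) Mm u c" by (rule Mm_contraction)
  then interpret M: weighted_contraction "n * n" Mm u c .
  obtain c' where "weighted_contraction n Rm v c'" by (rule Rm_contraction)
  then interpret R: weighted_contraction n Rm v c' .
  let ?K = M.neumann and ?G = R.neumann
  have TKS: "Tm * ?K * Sm \<in> carrier_mat n n" by (intro mult_carrier_mat[of _ n "n * n"]) auto
  have I: "1\<^sub>m n + Tm * ?K * Sm \<in> carrier_mat n n" using TKS by auto
  have "(1\<^sub>m n - Rm) * Zm * (1\<^sub>m n + Tm * ?K * Sm) = 1\<^sub>m n"
    unfolding Tm_Qm_Sm[symmetric]
    by (rule woodbury[of "1\<^sub>m (n * n) + Pm" "n * n"])
      (use Qm_mult_one_plus_Pm M.neumann_right_inverse one_minus_Mm in auto)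
  then have "(1\<^sub>m n - Rm) * (Zm * (1\<^sub>m n + Tm * ?K * Sm)) = 1\<^sub>m n"
    using assoc_mult_mat[OF minus_carrier_mat[OF carriers(1)] carriers(2) I, of "1\<^sub>m n"] by simp
  then have "?G * ((1\<^sub>m n - Rm) * (Zm * (1\<^sub>m n + Tm * ?K * Sm))) = ?G"
    using right_mult_one_mat[OF R.neumann_carrier] by simp
  moreover have "?G * ((1\<^sub>m n - Rm) * (Zm * (1\<^sub>m n + Tm * ?K * Sm)))
      = ?G * (1\<^sub>m n - Rm) * (Zm * (1\<^sub>m n + Tm * ?K * Sm))"
    by (rule assoc_mult_mat[symmetric, of _ n n _ n]) (auto intro!: minus_carrier_mat mult_carrier_mat[of Zm n n] I)
  ultimately have "?G = Zm * (1\<^sub>m n + Tm * ?K * Sm)"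
    unfolding R.neumann_left_inverse using mult_carrier_mat[OF carriers(2) I] by simp
  also have "\<dots> = Zm * 1\<^sub>m n + Zm * (Tm * ?K * Sm)"
    by (rule mult_add_distrib_mat[OF carriers(2) one_carrier_mat TKS])
  also have "Zm * 1\<^sub>m n = Zm" by (rule right_mult_one_mat[OF carriers(2)])
  finally have G: "?G = Zm + Zm * (Tm * ?K * Sm)" .
  have KS: "?K * Sm \<in> carrier_mat (n * n) n" by (rule mult_carrier_mat[OF M.neumann_carrier carriers(4)])
  have ZT: "Zm * Tm \<in> carrier_mat n (n * n)" by (rule mult_carrier_mat[OF carriers(2,5)])
  have "mat_trace ?G = (\<Sum>i<n. Zm $$ (i, i) + (Zm * (Tm * ?K * Sm)) $$ (i, i))"
    unfolding G by (simp add: mat_trace_def del: index_mult_mat(1))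
  also have "\<dots> = (\<Sum>i<n. z i) + mat_trace (Zm * (Tm * ?K * Sm))"
    by (simp add: sum.distrib mat_trace_def Zm_def del: index_mult_mat(1))
  also have "Zm * (Tm * ?K * Sm) = (Zm * Tm) * (?K * Sm)"
    using assoc_mult_mat[OF carriers(5) M.neumann_carrier carriers(4)] assoc_mult_mat[OF carriers(2,5) KS] by simp
  also have "mat_trace \<dots> = mat_trace ((?K * Sm) * (Zm * Tm))"
    by (rule mat_trace_mult_commute[OF ZT KS])
  also have "(?K * Sm) * (Zm * Tm) = ?K * Wm"
    using assoc_mult_mat[OF M.neumann_carrier carriers(4) ZT] by (simp add: Wm_eq)
  finally have tr: "mat_trace (?K * Wm) = mat_trace ?G - (\<Sum>i<n. z i)" by simp
  have trG: "(\<lambda>k. mat_trace (Rm ^\<^sub>m k)) sums mat_trace ?G"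
  proof -
    have "(\<lambda>k. \<Sum>i<n. (Rm ^\<^sub>m k) $$ (i, i)) sums (\<Sum>i<n. ?G $$ (i, i))"
      by (intro sums_sum R.neumann_sums) auto
    then show ?thesis by (simp add: mat_trace_def)
  qed
  then show "summable (\<lambda>k. mat_trace (Rm ^\<^sub>m k))" by (rule sums_summable)
  have "(\<lambda>k. \<Sum>e<n * n. (Mm ^\<^sub>m k * Wm) $$ (e, e)) sums (\<Sum>e<n * n. (?K * Wm) $$ (e, e))"
    by (intro sums_sum M.neumann_mult_sums[OF Wm_carrier(1)]) auto
  then have "(\<lambda>k. mat_trace (Mm ^\<^sub>m k * Wm)) sums mat_trace (?K * Wm)"
    by (simp add: mat_trace_def del: index_mult_mat(1))
  then show "(\<lambda>k. mat_trace (Mm ^\<^sub>m k * Wm)) sums ((\<Sum>k. mat_trace (Rm ^\<^sub>m k)) - (\<Sum>i<n. z i))"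
    unfolding tr using sums_unique[OF trG] by simp
qed

lemma Wm_nonneg: "e < n * n \<Longrightarrow> f < n * n \<Longrightarrow> Wm $$ (e, f) \<ge> 0"
  using Mm_nonneg Mm_le_Wm by fastforce

lemma Mm_pow_nonneg: "e < n * n \<Longrightarrow> f < n * n \<Longrightarrow> (Mm ^\<^sub>m k) $$ (e, f) \<ge> 0"
  using abs_pow_mat_le[of Mm "n * n" Mm e f k] Mm_nonneg by simp

lemma trace_Mm_Wm_entry:
  "mat_trace (Mm ^\<^sub>m k * Wm) = (\<Sum>e<n * n. \<Sum>f<n * n. (Mm ^\<^sub>m k) $$ (e, f) * Wm $$ (f, e))"
  using mat_mult_entry[of "Mm ^\<^sub>m k" "n * n" "n * n" Wm "n * n"]
  by (simp add: mat_trace_def del: index_mult_mat(1))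

lemma trace_Mm_Wm_nonneg: "mat_trace (Mm ^\<^sub>m k * Wm) \<ge> 0"
  unfolding trace_Mm_Wm_entry by (intro sum_nonneg mult_nonneg_nonneg Wm_nonneg Mm_pow_nonneg) auto

lemma trace_Mm_Suc_le: "mat_trace (Mm ^\<^sub>m Suc k) \<le> mat_trace (Mm ^\<^sub>m k * Wm)"
proof -
  have "mat_trace (Mm ^\<^sub>m Suc k) = (\<Sum>e<n * n. \<Sum>f<n * n. (Mm ^\<^sub>m k) $$ (e, f) * Mm $$ (f, e))"
    using mat_mult_entry[of "Mm ^\<^sub>m k" "n * n" "n * n" Mm "n * n"]
    by (simp add: mat_trace_def del: index_mult_mat(1))
  also have "\<dots> \<le> (\<Sum>e<n * n. \<Sum>f<n * n. (Mm ^\<^sub>m k) $$ (e, f) * Wm $$ (f, e))"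
    by (intro sum_mono mult_left_mono Mm_le_Wm Mm_pow_nonneg) auto
  finally show ?thesis by (simp only: trace_Mm_Wm_entry)
qed

text \<open>A nonzero term yields a closed walk of \<open>k + 1\<close> edges whose inner turns do
  not backtrack, and such a walk contains a cycle of length at most \<open>k + 1\<close>.\<close>

lemma trace_Mm_Wm_eq_0:
  assumes no_cycle: "\<And>l y. 3 \<le> l \<Longrightarrow> l < g \<Longrightarrow> inj_on y {..<l} \<Longrightarrow>
      \<exists>i<l. \<not> (y i < n \<and> y (Suc i mod l) < n \<and> y i \<noteq> y (Suc i mod l) \<and> r (y i) (y (Suc i mod l)) \<noteq> 0)"
    and k: "Suc k < g"
  shows "mat_trace (Mm ^\<^sub>m k * Wm) = 0"
proof (rule ccontr)
  assume "mat_trace (Mm ^\<^sub>m k * Wm) \<noteq> 0"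
  then obtain e where e: "e < n * n" "(\<Sum>f<n * n. (Mm ^\<^sub>m k) $$ (e, f) * Wm $$ (f, e)) \<noteq> 0"
    unfolding trace_Mm_Wm_entry using sum.not_neutral_contains_not_neutral by (metis (no_types, lifting) lessThan_iff)
  then obtain f where f: "f < n * n" "(Mm ^\<^sub>m k) $$ (e, f) \<noteq> 0" "Wm $$ (f, e) \<noteq> 0"
    using sum.not_neutral_contains_not_neutral by (metis (no_types, lifting) lessThan_iff mult_eq_0_iff)
  then obtain p where p: "p 0 = e" "p k = f" "\<And>l. l < k \<Longrightarrow> Mm $$ (p l, p (Suc l)) \<noteq> 0" "\<And>l. l \<le> k \<Longrightarrow> p l < n * n"
    using pow_mat_nonzero_walk[OF carriers(3) e(1), of f k] by blast
  \<comment> \<open>The vertices in the order in which the powers of \<open>Mm\<close> read the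
    walk: the head of the first edge, then the tails of the successive edges. The factor
    \<open>Wm\<close> identifies the last tail with the first head.\<close>
  define x where "x l = (case l of 0 \<Rightarrow> p 0 mod n | Suc l \<Rightarrow> p l div n)" for l
  let ?E = "\<lambda>i j. i < n \<and> j < n \<and> i \<noteq> j \<and> r i j \<noteq> 0"
  have M: "p (Suc l) mod n = p l div n" "p (Suc l) div n \<noteq> p l mod n" "we (p l) \<noteq> 0" if "l < k" for l
    using p(3)[OF that] Mm_entry[of "p l" "p (Suc l)"] p(4)[of l] p(4)[of "Suc l"] that by (auto split: if_splits)
  have W: "e mod n = f div n" "we f \<noteq> 0" using f e by (auto simp: Wm_def split: if_splits)
  have head: "x l = p l mod n" if "l \<le> k" for l
    using that M(1)[of "l - 1"] by (cases l) (auto simp: x_def)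
  have we: "we (p l) \<noteq> 0" if "l \<le> k" for l using that M(3)[of l] W(2) p(2) by (cases "l = k") auto
  have edge: "?E (x l) (x (Suc l))" if "l < Suc k" for l
  proof -
    note d = edge_index_div_mod[OF p(4), of l]
    have "x (Suc l) = p l div n" by (simp add: x_def)
    then show ?thesis using head[of l] we[of l] d that w_diag[of "p l mod n"] sym[of "p l mod n" "p l div n"]
      by (auto simp: w_def)
  qed
  have "x (Suc k) = x 0" using W(1) p(1,2) by (simp add: x_def)
  moreover have "x l \<noteq> x (l + 2)" if "l + 2 \<le> Suc k" for l
    using M(2)[of l] head[of l] that by (auto simp: x_def)
  ultimately obtain l y where "3 \<le> l" "l \<le> Suc k" "inj_on y {..<l}" "\<And>i. i < l \<Longrightarrow> ?E (y i) (y (Suc i mod l))"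
    using nonbacktracking_imp_cycle[of "Suc k" x ?E] edge by auto
  then show False using no_cycle[of l y] k by (metis le_less_trans)
qed

end

subsection \<open>Convergence of the messages\<close>

text \<open>The spectral hypothesis is represented by \<open>v\<close>. The same \<open>v\<close>
  serves every \<open>t R\<close> with \<open>0 \<le> t \<le> 1\<close>, so the whole theory can be
  instantiated along the scaling.\<close>

locale gabp_matrix =
  fixes n :: nat and R :: "real mat" and v :: "nat \<Rightarrow> real"
  assumes R_carrier: "R \<in> carrier_mat n n"
    and R_sym: "\<And>i j. i < n \<Longrightarrow> j < n \<Longrightarrow> R $$ (i, j) = R $$ (j, i)"
    and R_diag: "\<And>i. i < n \<Longrightarrow> R $$ (i, i) = 0"
    and v_ge_1: "\<And>i. i < n \<Longrightarrow> v i \<ge> 1"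
    and R_super: "\<And>i. i < n \<Longrightarrow> 1 + (\<Sum>j<n. \<bar>R $$ (i, j)\<bar> * v j) \<le> v i"
begin

lemma v_pos: "i < n \<Longrightarrow> v i > 0" using v_ge_1[of i] by simp

lemma alpha_iter_eq_0: "R $$ (i, j) = 0 \<Longrightarrow> alpha_iter R s i j = 0"
  by (cases s) auto

lemma sum_nbrs:
  assumes i: "i < n" and F: "\<And>k. k < n \<Longrightarrow> R $$ (k, i) = 0 \<Longrightarrow> F k = 0"
  shows "(\<Sum>k\<in>nbrs R i - X. F k) = (\<Sum>k\<in>{..<n} - X. F k)"
proof (rule sum.mono_neutral_left)
  show "nbrs R i - X \<subseteq> {..<n} - X" using R_carrier by (auto simp: nbrs_def gedge_def)
  show "\<forall>k\<in>{..<n} - X - (nbrs R i - X). F k = 0"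
  proof
    fix k assume k: "k \<in> {..<n} - X - (nbrs R i - X)"
    then have "k = i \<or> R $$ (i, k) = 0" using R_carrier i by (auto simp: nbrs_def gedge_def)
    then have "R $$ (k, i) = 0" using R_sym[of k i] R_diag[OF i] i k by auto
    then show "F k = 0" using F k by auto
  qed
qed simp

lemma alpha_iter_Suc:
  "i < n \<Longrightarrow> alpha_iter R (Suc s) i j = (R $$ (i, j))\<^sup>2 / (1 - (\<Sum>k\<in>{..<n} - {j}. alpha_iter R s k i))"
  using sum_nbrs[of i "\<lambda>k. alpha_iter R s k i" "{j}"] by (simp add: alpha_iter_eq_0 divide_inverse)

text \<open>Stated for arbitrary \<open>x\<close> so that it serves both the iterates and their
  limits. The assumption reduces the sum to one controlled by \<open>R_super\<close>, and omitting
  \<open>j\<close> leaves room for the term with \<open>v j\<close>.\<close>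

lemma cavity_sum_le:
  assumes "i < n" "j < n" and b: "\<And>k. k < n \<Longrightarrow> x k * v i \<le> \<bar>R $$ (k, i)\<bar> * v k"
  shows "1 + \<bar>R $$ (i, j)\<bar> * v j \<le> (1 - (\<Sum>k\<in>{..<n} - {j}. x k)) * v i"
proof -
  have "(\<Sum>k\<in>{..<n} - {j}. x k) * v i \<le> (\<Sum>k\<in>{..<n} - {j}. \<bar>R $$ (i, k)\<bar> * v k)"
    unfolding sum_distrib_right
  proof (rule sum_mono)
    fix k assume "k \<in> {..<n} - {j}"
    then show "x k * v i \<le> \<bar>R $$ (i, k)\<bar> * v k" using b[of k] R_sym[OF assms(1), of k] by simp
  qed
  also have "\<dots> = (\<Sum>k<n. \<bar>R $$ (i, k)\<bar> * v k) - \<bar>R $$ (i, j)\<bar> * v j"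
    using assms by (simp add: sum_diff1)
  finally show ?thesis using R_super[OF assms(1)] by (simp add: algebra_simps)
qed

lemma cavity_sum_less_1:
  assumes "i < n" "j < n" "\<And>k. k < n \<Longrightarrow> x k * v i \<le> \<bar>R $$ (k, i)\<bar> * v k"
  shows "(\<Sum>k\<in>{..<n} - {j}. x k) < 1"
proof -
  have "0 \<le> \<bar>R $$ (i, j)\<bar> * v j" using v_pos[OF assms(2)] by simp
  then have "0 < (1 - (\<Sum>k\<in>{..<n} - {j}. x k)) * v i" using cavity_sum_le[OF assms] by linarith
  then show ?thesis using v_pos[OF assms(1)] by (simp add: zero_less_mult_iff)
qed

text \<open>The weighted bound is an invariant of the iteration: \<open>cavity_sum_le\<close> keeps
  the denominator positive and, multiplied by the absolute entry and divided by the denominator,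
  reproduces the bound.\<close>

lemma alpha_iter_bounds:
  "i < n \<Longrightarrow> j < n \<Longrightarrow> 0 \<le> alpha_iter R s i j \<and> alpha_iter R s i j * v j \<le> \<bar>R $$ (i, j)\<bar> * v i"
proof (induction s arbitrary: i j)
  case 0
  then show ?case using v_pos[of i] by simp
next
  case (Suc s)
  let ?c = "1 - (\<Sum>k\<in>{..<n} - {j}. alpha_iter R s k i)"
  have b: "alpha_iter R s k i * v i \<le> \<bar>R $$ (k, i)\<bar> * v k" if "k < n" for k
    using Suc.IH[OF that Suc.prems(1)] by blast
  have c: "?c > 0" using cavity_sum_less_1[OF Suc.prems b] by simp
  have "\<bar>R $$ (i, j)\<bar> * (\<bar>R $$ (i, j)\<bar> * v j) \<le> \<bar>R $$ (i, j)\<bar> * (?c * v i)"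
    using cavity_sum_le[OF Suc.prems b] by (intro mult_left_mono) auto
  then have "(R $$ (i, j))\<^sup>2 * v j \<le> \<bar>R $$ (i, j)\<bar> * v i * ?c"
    by (simp add: power2_abs[of "R $$ (i, j)", symmetric] power2_eq_square mult_ac del: power2_abs)
  then have "(R $$ (i, j))\<^sup>2 / ?c * v j \<le> \<bar>R $$ (i, j)\<bar> * v i"
    using c by (simp add: pos_divide_le_eq)
  then show ?case using c by (simp add: alpha_iter_Suc[OF Suc.prems(1)] del: alpha_iter.simps)
qed

lemma alpha_iter_sum_less_1:
  assumes "i < n" "j < n" shows "(\<Sum>k\<in>{..<n} - {j}. alpha_iter R s k i) < 1"
  by (rule cavity_sum_less_1[OF assms]) (simp add: alpha_iter_bounds assms)

text \<open>Larger messages shrink the denominators, so the iteration started at 0 increases; with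
  the bound above it converges.\<close>

lemma alpha_iter_mono: "i < n \<Longrightarrow> j < n \<Longrightarrow> alpha_iter R s i j \<le> alpha_iter R (Suc s) i j"
proof (induction s arbitrary: i j)
  case 0
  then show ?case using alpha_iter_bounds[of i j "Suc 0"] by simp
next
  case (Suc s)
  have "(\<Sum>k\<in>{..<n} - {j}. alpha_iter R s k i) \<le> (\<Sum>k\<in>{..<n} - {j}. alpha_iter R (Suc s) k i)"
    using Suc by (intro sum_mono) auto
  then show ?case
    unfolding alpha_iter_Suc[OF Suc.prems(1), of s] alpha_iter_Suc[OF Suc.prems(1), of "Suc s"]
    using alpha_iter_sum_less_1[OF Suc.prems, of "Suc s"] alpha_iter_sum_less_1[OF Suc.prems, of s]
    by (intro divide_left_mono) auto
qed

lemma alpha_iter_tendsto: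
  assumes ij: "i < n" "j < n" shows "(\<lambda>s. alpha_iter R s i j) \<longlonglongrightarrow> alpha R i j"
proof -
  have "incseq (\<lambda>s. alpha_iter R s i j)" using alpha_iter_mono[OF ij] by (rule incseq_SucI)
  moreover have "alpha_iter R s i j \<le> \<bar>R $$ (i, j)\<bar> * v i / v j" for s
    using alpha_iter_bounds[OF ij, of s] v_pos[OF ij(2)] by (simp add: pos_le_divide_eq)
  ultimately obtain L where "(\<lambda>s. alpha_iter R s i j) \<longlonglongrightarrow> L" using incseq_convergent by blast
  then have "convergent (\<lambda>s. alpha_iter R s i j)" by (rule convergentI)
  then show ?thesis by (simp add: alpha_def convergent_LIMSEQ_iff)
qed

lemma alpha_nonneg: assumes "i < n" "j < n" shows "alpha R i j \<ge> 0"
  using alpha_iter_bounds[OF assms] by (intro LIMSEQ_le_const[OF alpha_iter_tendsto[OF assms]]) auto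

lemma alpha_le: assumes "i < n" "j < n" shows "alpha R i j * v j \<le> \<bar>R $$ (i, j)\<bar> * v i"
  using alpha_iter_bounds[OF assms]
  by (intro LIMSEQ_le_const2[OF tendsto_mult_right[OF alpha_iter_tendsto[OF assms]]]) auto

lemma alpha_cavity_less_1: assumes "i < n" "j < n" shows "(\<Sum>k\<in>{..<n} - {j}. alpha R k i) < 1"
  by (rule cavity_sum_less_1[OF assms]) (simp add: alpha_le assms)

lemma alpha_eq:
  assumes ij: "i < n" "j < n"
  shows "alpha R i j = (R $$ (i, j))\<^sup>2 / (1 - (\<Sum>k\<in>{..<n} - {j}. alpha R k i))"
proof (rule LIMSEQ_unique)
  show "(\<lambda>s. alpha_iter R (Suc s) i j) \<longlonglongrightarrow> alpha R i j"
    using alpha_iter_tendsto[OF ij] by (rule LIMSEQ_Suc)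
  show "(\<lambda>s. alpha_iter R (Suc s) i j) \<longlonglongrightarrow> (R $$ (i, j))\<^sup>2 / (1 - (\<Sum>k\<in>{..<n} - {j}. alpha R k i))"
    unfolding alpha_iter_Suc[OF ij(1)] using alpha_cavity_less_1[OF ij] ij
    by (intro tendsto_intros alpha_iter_tendsto) auto
qed

text \<open>Bounds the node factor by \<open>v i\<close>, uniformly in the scaling because
  \<open>v\<close> stays the same.\<close>

lemma alpha_sum_le:
  assumes i: "i < n" shows "1 \<le> (1 - (\<Sum>k<n. alpha R k i)) * v i"
proof -
  have "(\<Sum>k<n. alpha R k i) * v i \<le> (\<Sum>k<n. \<bar>R $$ (i, k)\<bar> * v k)"
    unfolding sum_distrib_right
  proof (rule sum_mono)
    fix k assume "k \<in> {..<n}"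
    then show "alpha R k i * v i \<le> \<bar>R $$ (i, k)\<bar> * v k" using alpha_le[of k i] R_sym[OF i, of k] i by simp
  qed
  then show ?thesis using R_super[OF i] by (simp add: algebra_simps)
qed

lemma alpha_sum_less_1: assumes "i < n" shows "(\<Sum>k<n. alpha R k i) < 1"
proof -
  have "0 < (1 - (\<Sum>k<n. alpha R k i)) * v i" using alpha_sum_le[OF assms] by linarith
  then show ?thesis using v_pos[OF assms] by (simp add: zero_less_mult_iff)
qed

lemma alpha_sum_diff: "j < n \<Longrightarrow> (\<Sum>k\<in>{..<n} - {j}. alpha R k i) = (\<Sum>k<n. alpha R k i) - alpha R j i"
  by (simp add: sum_diff1)

lemma alpha_fixpoint:
  assumes "i < n" "j < n"
  shows "alpha R i j * (1 - (\<Sum>k<n. alpha R k i) + alpha R j i) = (R $$ (i, j))\<^sup>2"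
proof -
  let ?c = "1 - (\<Sum>k\<in>{..<n} - {j}. alpha R k i)"
  have c: "1 - (\<Sum>k<n. alpha R k i) + alpha R j i = ?c" by (simp add: alpha_sum_diff[OF assms(2)])
  have "?c > 0" using alpha_cavity_less_1[OF assms] by simp
  then show ?thesis unfolding c by (subst alpha_eq[OF assms]) simp
qed

lemma is_bp_fixpoint: "bp_fixpoint n (\<lambda>i j. R $$ (i, j)) (alpha R)"
  by unfold_locales (simp_all add: R_diag alpha_fixpoint alpha_nonneg alpha_sum_less_1, rule R_sym)

lemma is_bp_supersolution: "bp_supersolution n (\<lambda>i j. \<bar>R $$ (i, j)\<bar>) (alpha R) v"
proof unfold_locales
  show "\<bar>R $$ (i, j)\<bar> = \<bar>R $$ (j, i)\<bar>" if "i < n" "j < n" for i j using R_sym[OF that] by simp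
qed (simp_all add: R_diag alpha_fixpoint alpha_nonneg alpha_sum_less_1 R_super v_pos alpha_le)

lemma alpha_iter_scaled_le:
  assumes t: "0 \<le> t" "t \<le> 1" and s: "gabp_matrix n (t \<cdot>\<^sub>m R) v"
  shows "i < n \<Longrightarrow> j < n \<Longrightarrow> alpha_iter (t \<cdot>\<^sub>m R) m i j \<le> alpha_iter R m i j"
proof (induction m arbitrary: i j)
  case (Suc m)
  interpret T: gabp_matrix n "t \<cdot>\<^sub>m R" v by fact
  have 1: "(\<Sum>k\<in>{..<n} - {j}. alpha_iter (t \<cdot>\<^sub>m R) m k i) \<le> (\<Sum>k\<in>{..<n} - {j}. alpha_iter R m k i)"
    using Suc by (intro sum_mono) auto
  have "t\<^sup>2 * (R $$ (i, j))\<^sup>2 \<le> 1 * (R $$ (i, j))\<^sup>2"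
    using t by (intro mult_right_mono) (auto simp: power_le_one)
  then have 2: "((t \<cdot>\<^sub>m R) $$ (i, j))\<^sup>2 \<le> (R $$ (i, j))\<^sup>2"
    using R_carrier Suc.prems by (simp add: power_mult_distrib)
  show ?case
    unfolding alpha_iter_Suc[OF Suc.prems(1)] T.alpha_iter_Suc[OF Suc.prems(1)]
    using 1 2 alpha_iter_sum_less_1[OF Suc.prems, of m] by (intro frac_le) auto
qed simp

lemma scaled: assumes t: "0 \<le> t" "t \<le> 1" shows "gabp_matrix n (t \<cdot>\<^sub>m R) v"
proof unfold_locales
  fix i assume i: "i < n"
  have "(\<Sum>j<n. \<bar>(t \<cdot>\<^sub>m R) $$ (i, j)\<bar> * v j) \<le> (\<Sum>j<n. \<bar>R $$ (i, j)\<bar> * v j)"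
  proof (rule sum_mono)
    fix j assume "j \<in> {..<n}"
    then have "t * (\<bar>R $$ (i, j)\<bar> * v j) \<le> 1 * (\<bar>R $$ (i, j)\<bar> * v j)"
      using t v_pos[of j] by (intro mult_right_mono) auto
    then show "\<bar>(t \<cdot>\<^sub>m R) $$ (i, j)\<bar> * v j \<le> \<bar>R $$ (i, j)\<bar> * v j"
      using R_carrier i \<open>j \<in> {..<n}\<close> t by (simp add: abs_mult mult.assoc)
  qed
  then show "1 + (\<Sum>j<n. \<bar>(t \<cdot>\<^sub>m R) $$ (i, j)\<bar> * v j) \<le> v i" using R_super[OF i] by simp
next
  show "(t \<cdot>\<^sub>m R) $$ (i, j) = (t \<cdot>\<^sub>m R) $$ (j, i)" if "i < n" "j < n" for i j
    using R_sym[OF that] R_carrier that by simp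
qed (use R_carrier R_diag v_ge_1 in auto)

lemma alpha_scaled_le:
  assumes t: "0 \<le> t" "t \<le> 1" and ij: "i < n" "j < n"
  shows "alpha (t \<cdot>\<^sub>m R) i j \<le> alpha R i j"
proof -
  interpret T: gabp_matrix n "t \<cdot>\<^sub>m R" v by (rule scaled[OF t])
  show ?thesis
    by (rule LIMSEQ_le[OF T.alpha_iter_tendsto[OF ij] alpha_iter_tendsto[OF ij]])
      (use alpha_iter_scaled_le[OF t scaled[OF t] ij] in auto)
qed

end

subsection \<open>Polynomial minorants of the messages\<close>

text \<open>Letting \<open>t\<close> tend to 0 from the right kills the constant term; dividing by
  \<open>t\<close> then lowers \<open>g\<close> by one.\<close>

lemma coeff_eq_0_of_bound:
  fixes p :: "real poly"
  assumes "\<And>t. 0 < t \<Longrightarrow> t \<le> 1 \<Longrightarrow> \<bar>poly p t\<bar> \<le> C * t ^ g"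
  shows "k < g \<Longrightarrow> coeff p k = 0"
  using assms
proof (induction g arbitrary: p k)
  case (Suc g)
  have ev: "\<forall>\<^sub>F t in at_right 0. 0 < t \<and> t \<le> (1 :: real)"
    by (auto simp: eventually_at_right_field intro!: exI[of _ 1])
  have "((\<lambda>t. \<bar>poly p t\<bar>) \<longlongrightarrow> \<bar>poly p 0\<bar>) (at_right 0)"
    by (intro tendsto_intros)
  moreover have "((\<lambda>t. C * t ^ Suc g) \<longlongrightarrow> C * 0 ^ Suc g) (at_right (0 :: real))"
    by (intro tendsto_intros)
  moreover have "\<forall>\<^sub>F t in at_right 0. \<bar>poly p t\<bar> \<le> C * t ^ Suc g"
    using ev by eventually_elim (use Suc.prems in auto)
  ultimately have "\<bar>poly p 0\<bar> \<le> C * 0 ^ Suc g" by (intro tendsto_le[of "at_right (0 :: real)"]) auto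
  then have "poly p 0 = 0" by simp
  obtain c q where p: "p = pCons c q" by (cases p)
  then have "c = 0" using \<open>poly p 0 = 0\<close> by simp
  have "\<bar>poly q t\<bar> \<le> C * t ^ g" if "0 < t" "t \<le> 1" for t
  proof -
    have "t * \<bar>poly q t\<bar> \<le> t * (C * t ^ g)"
      using Suc.prems(2)[OF that] that by (simp add: p \<open>c = 0\<close> abs_mult algebra_simps)
    then show ?thesis using that by simp
  qed
  then show ?case using Suc.IH[of _ q] Suc.prems(1) by (cases k) (auto simp: p \<open>c = 0\<close>)
qed simp

section \<open>Polynomials with nonnegative coefficients\<close>

definition nonneg_poly :: "real poly \<Rightarrow> bool" where
  "nonneg_poly p \<longleftrightarrow> (\<forall>k. coeff p k \<ge> 0)"

lemma nonneg_poly_mult: "nonneg_poly p \<Longrightarrow> nonneg_poly q \<Longrightarrow> nonneg_poly (p * q)"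
  by (auto simp: nonneg_poly_def coeff_mult intro!: sum_nonneg)

lemma nonneg_poly_sum: "(\<And>x. x \<in> A \<Longrightarrow> nonneg_poly (f x)) \<Longrightarrow> nonneg_poly (\<Sum>x\<in>A. f x)"
  by (auto simp: nonneg_poly_def coeff_sum intro!: sum_nonneg)

lemma nonneg_poly_power: "nonneg_poly p \<Longrightarrow> nonneg_poly (p ^ k)"
  by (induction k) (auto simp: nonneg_poly_mult, auto simp: nonneg_poly_def coeff_1)

lemma nonneg_poly_nonneg: "nonneg_poly p \<Longrightarrow> t \<ge> 0 \<Longrightarrow> poly p t \<ge> 0"
  by (auto simp: nonneg_poly_def poly_altdef intro!: sum_nonneg)

text \<open>This turns knowledge of the low coefficients into an inequality at
  \<open>t = 1\<close>.\<close>

lemma nonneg_poly_sum_coeff_le: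
  assumes "nonneg_poly p" shows "(\<Sum>k<g. coeff p k) \<le> poly p 1"
proof -
  have "(\<Sum>k<g. coeff p k) \<le> (\<Sum>k<max g (Suc (degree p)). coeff p k)"
    using assms by (intro sum_mono2) (auto simp: nonneg_poly_def)
  also have "\<dots> = (\<Sum>k\<le>degree p. coeff p k)"
    by (rule sum.mono_neutral_right) (auto simp: coeff_eq_0)
  finally show ?thesis by (simp add: poly_altdef)
qed

text \<open>In use, \<open>x\<close> is an exact sum of messages and \<open>y\<close> a polynomial
  minorant of it, while \<open>V\<close> bounds the reciprocal of \<open>1 - x\<close>. The error
  has two sources, separated in \<open>eq\<close>: truncating the series and replacing
  \<open>x\<close> by \<open>y\<close>.\<close>

lemma geometric_approx:
  fixes x y t :: real
  assumes "0 \<le> y" "y \<le> x" "1 \<le> (1 - x) * V" "x \<le> t" "0 < t" "t \<le> 1" "x - y \<le> C * t ^ s" "V \<ge> 0"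
  shows "(\<Sum>l\<le>m. y ^ l) \<le> 1 / (1 - x)"
    and "s \<le> Suc m \<Longrightarrow> 1 / (1 - x) - (\<Sum>l\<le>m. y ^ l) \<le> V * (1 + (real m + 1) * C) * t ^ s"
proof -
  have "x < 1" using assms(3,8) by (metis less_eq_real_def linorder_not_less mult_nonpos_nonneg
        diff_le_0_iff_le not_one_le_zero order_trans)
  let ?S = "\<Sum>l\<le>m. y ^ l"
  have S0: "?S \<ge> 0" using assms by (intro sum_nonneg) auto
  have "?S \<le> (\<Sum>l\<le>m. 1)" using assms \<open>x < 1\<close> by (intro sum_mono power_le_one) auto
  then have S1: "?S \<le> real m + 1" by simp
  have "(1 - y) * ?S = 1 - y ^ Suc m" unfolding lessThan_Suc_atMost[symmetric] by (rule one_diff_power_eq[symmetric])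
  then have eq: "1 - (1 - x) * ?S = y ^ Suc m + (x - y) * ?S" by (simp add: algebra_simps)
  have eq': "1 / (1 - x) - ?S = (1 / (1 - x)) * (y ^ Suc m + (x - y) * ?S)"
    unfolding eq[symmetric] using \<open>x < 1\<close> by (simp add: field_simps)
  have nn: "y ^ Suc m + (x - y) * ?S \<ge> 0"
    using assms S0 by (intro add_nonneg_nonneg mult_nonneg_nonneg zero_le_power) auto
  have "0 \<le> 1 / (1 - x) - ?S" unfolding eq' using \<open>x < 1\<close> nn by (intro mult_nonneg_nonneg) auto
  then show "?S \<le> 1 / (1 - x)" by simp
  assume s: "s \<le> Suc m"
  have "1 / (1 - x) \<le> V" using assms(3) \<open>x < 1\<close> by (simp add: pos_divide_le_eq mult.commute)
  moreover have "y ^ Suc m + (x - y) * ?S \<le> (1 + (real m + 1) * C) * t ^ s"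
  proof -
    have "y ^ Suc m \<le> t ^ Suc m" using assms by (intro power_mono) auto
    also have "\<dots> \<le> t ^ s" using assms s by (intro power_decreasing) auto
    finally have a: "y ^ Suc m \<le> t ^ s" .
    have "(x - y) * ?S \<le> (x - y) * (real m + 1)" using assms S1 by (intro mult_left_mono) auto
    also have "\<dots> \<le> (C * t ^ s) * (real m + 1)" using assms by (intro mult_right_mono) auto
    finally show ?thesis using a by (simp add: algebra_simps)
  qed
  ultimately show "1 / (1 - x) - ?S \<le> V * (1 + (real m + 1) * C) * t ^ s"
    unfolding eq' mult.assoc using nn assms(8) by (intro mult_mono) auto
qed

text \<open>The message recursion for \<open>t R\<close> as a polynomial in \<open>t\<close>: the
  squared entry acquires the square of \<open>t\<close>, and the reciprocal becomes a truncated
  geometric series, which keeps all coefficients nonnegative.\<close>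

fun message_poly :: "nat \<Rightarrow> real mat \<Rightarrow> nat \<Rightarrow> nat \<Rightarrow> nat \<Rightarrow> real poly" where
  "message_poly n R 0 i j = 0"
| "message_poly n R (Suc s) i j =
     [:0, 0, (R $$ (i, j))\<^sup>2:] * (\<Sum>l\<le>s. (\<Sum>k\<in>{..<n} - {j}. message_poly n R s k i) ^ l)"

definition node_poly :: "nat \<Rightarrow> real mat \<Rightarrow> nat \<Rightarrow> nat \<Rightarrow> real poly" where
  "node_poly n R s i = (\<Sum>l\<le>s. (\<Sum>k<n. message_poly n R s k i) ^ l)"

lemma nonneg_message_poly: "nonneg_poly (message_poly n R s i j)"
proof (induction s arbitrary: i j)
  case (Suc s)
  have "nonneg_poly [:0, 0, (R $$ (i, j))\<^sup>2:]"
    by (auto simp: nonneg_poly_def coeff_pCons split: nat.splits)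
  then show ?case
    unfolding message_poly.simps by (intro nonneg_poly_mult nonneg_poly_sum nonneg_poly_power Suc)
qed (simp add: nonneg_poly_def)

lemma nonneg_node_poly: "nonneg_poly (node_poly n R s i)"
  unfolding node_poly_def by (intro nonneg_poly_sum nonneg_poly_power nonneg_message_poly)

section \<open>Order of approximation of the minorants\<close>

context gabp_matrix
begin

text \<open>Supplies the hypothesis \<open>x \<le> t\<close> of \<open>geometric_approx\<close>: the
  weighted bound on messages is linear in the matrix entries.\<close>

lemma scaled_sum_le:
  assumes t: "0 < t" "t \<le> 1" and i: "i < n"
  shows "(\<Sum>k<n. alpha (t \<cdot>\<^sub>m R) k i) \<le> t"
proof -
  interpret T: gabp_matrix n "t \<cdot>\<^sub>m R" v by (rule scaled) (use t in auto)
  have "(\<Sum>k<n. alpha (t \<cdot>\<^sub>m R) k i) * v i \<le> (\<Sum>k<n. t * (\<bar>R $$ (i, k)\<bar> * v k))"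
    unfolding sum_distrib_right
  proof (rule sum_mono)
    fix k assume k: "k \<in> {..<n}"
    then show "alpha (t \<cdot>\<^sub>m R) k i * v i \<le> t * (\<bar>R $$ (i, k)\<bar> * v k)"
      using T.alpha_le[of k i] R_carrier i t R_sym[OF i, of k] by (simp add: abs_mult mult.assoc)
  qed
  also have "\<dots> \<le> t * v i" unfolding sum_distrib_left[symmetric] using R_super[OF i] t by (intro mult_left_mono) auto
  finally show ?thesis using v_pos[OF i] by simp
qed

text \<open>Induction on \<open>s\<close> with constants uniform in \<open>t\<close>,
  \<open>i\<close> and \<open>j\<close>. Of the two factors \<open>t\<close> in front of the
  reciprocal, one raises the order of the error and the other is bounded by 1.\<close>

lemma message_poly_approx:
  "\<exists>C\<ge>0. \<forall>t i j. 0 < t \<longrightarrow> t \<le> 1 \<longrightarrow> i < n \<longrightarrow> j < n \<longrightarrow>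
     poly (message_poly n R s i j) t \<le> alpha (t \<cdot>\<^sub>m R) i j \<and>
     alpha (t \<cdot>\<^sub>m R) i j - poly (message_poly n R s i j) t \<le> C * t ^ s"
proof (induction s)
  case 0
  have "alpha (t \<cdot>\<^sub>m R) i j \<le> 1" "alpha (t \<cdot>\<^sub>m R) i j \<ge> 0" if "0 < t" "t \<le> 1" "i < n" "j < n" for t i j
  proof -
    interpret T: gabp_matrix n "t \<cdot>\<^sub>m R" v by (rule scaled) (use that in auto)
    show "alpha (t \<cdot>\<^sub>m R) i j \<ge> 0" by (rule T.alpha_nonneg[OF that(3,4)])
    have "alpha (t \<cdot>\<^sub>m R) i j \<le> (\<Sum>k<n. alpha (t \<cdot>\<^sub>m R) k j)"
      using that by (intro member_le_sum) (auto intro: T.alpha_nonneg)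
    then show "alpha (t \<cdot>\<^sub>m R) i j \<le> 1" using scaled_sum_le[OF that(1,2,4)] that by simp
  qed
  then show ?case by (intro exI[of _ 1]) auto
next
  case (Suc s)
  then obtain C where C: "C \<ge> 0" and IH: "\<And>t i j. 0 < t \<Longrightarrow> t \<le> 1 \<Longrightarrow> i < n \<Longrightarrow> j < n \<Longrightarrow>
     poly (message_poly n R s i j) t \<le> alpha (t \<cdot>\<^sub>m R) i j \<and>
     alpha (t \<cdot>\<^sub>m R) i j - poly (message_poly n R s i j) t \<le> C * t ^ s" by blast
  define V where "V = (\<Sum>i<n. v i)"
  define B where "B = (\<Sum>i<n. \<Sum>j<n. (R $$ (i, j))\<^sup>2)"
  define D where "D = V * (1 + (real s + 1) * (n * C))"
  have V: "v i \<le> V" if "i < n" for i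
    unfolding V_def using that by (intro member_le_sum) (auto intro: less_imp_le[OF v_pos])
  have B: "(R $$ (i, j))\<^sup>2 \<le> B" if "i < n" "j < n" for i j
  proof -
    have "(R $$ (i, j))\<^sup>2 \<le> (\<Sum>j<n. (R $$ (i, j))\<^sup>2)" using that by (intro member_le_sum) auto
    also have "\<dots> \<le> B" unfolding B_def using that by (intro member_le_sum) (auto intro: sum_nonneg)
    finally show ?thesis .
  qed
  have V0: "V \<ge> 0" unfolding V_def by (intro sum_nonneg) (auto intro: less_imp_le[OF v_pos])
  have B0: "B \<ge> 0" unfolding B_def by (intro sum_nonneg) auto
  have D0: "D \<ge> 0" unfolding D_def using V0 C by (intro mult_nonneg_nonneg add_nonneg_nonneg) auto
  show ?case
  proof (intro exI[of _ "B * D"] conjI allI impI)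
    show "B * D \<ge> 0" using B0 D0 by simp
  next
    fix t i j assume t: "0 < t" "t \<le> (1 :: real)" and ij: "i < n" "j < n"
    interpret T: gabp_matrix n "t \<cdot>\<^sub>m R" v by (rule scaled) (use t in auto)
    let ?x = "\<Sum>k\<in>{..<n} - {j}. alpha (t \<cdot>\<^sub>m R) k i"
    let ?y = "\<Sum>k\<in>{..<n} - {j}. poly (message_poly n R s k i) t"
    have xs: "?x \<le> (\<Sum>k<n. alpha (t \<cdot>\<^sub>m R) k i)"
      using ij by (intro sum_mono2) (auto intro: T.alpha_nonneg)
    have "1 \<le> (1 - (\<Sum>k<n. alpha (t \<cdot>\<^sub>m R) k i)) * v i" by (rule T.alpha_sum_le[OF ij(1)])
    also have "\<dots> \<le> (1 - ?x) * V"
      using xs V[OF ij(1)] T.alpha_cavity_less_1[OF ij] v_pos[OF ij(1)] by (intro mult_mono) auto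
    finally have x1: "1 \<le> (1 - ?x) * V" .
    have y0: "0 \<le> ?y" using t by (intro sum_nonneg nonneg_poly_nonneg nonneg_message_poly) auto
    have yx: "?y \<le> ?x" using IH t ij by (intro sum_mono) auto
    have "?x - ?y \<le> (\<Sum>k\<in>{..<n} - {j}. C * t ^ s)"
      unfolding sum_subtractf[symmetric] using IH t ij by (intro sum_mono) auto
    also have "\<dots> \<le> (\<Sum>k<n. C * t ^ s)" using C t by (intro sum_mono2) auto
    finally have d: "?x - ?y \<le> (n * C) * t ^ s" by (simp add: mult.assoc)
    have xt: "?x \<le> t" using xs scaled_sum_le[OF t ij(1)] by simp
    note ga = geometric_approx[OF y0 yx x1 xt t d V0, of s]
    have al: "alpha (t \<cdot>\<^sub>m R) i j = (t\<^sup>2 * (R $$ (i, j))\<^sup>2) * (1 / (1 - ?x))"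
      using T.alpha_eq[OF ij] R_carrier ij by (simp add: power_mult_distrib)
    have po: "poly (message_poly n R (Suc s) i j) t = (t\<^sup>2 * (R $$ (i, j))\<^sup>2) * (\<Sum>l\<le>s. ?y ^ l)"
      by (simp add: poly_sum power2_eq_square algebra_simps)
    show "poly (message_poly n R (Suc s) i j) t \<le> alpha (t \<cdot>\<^sub>m R) i j"
      unfolding al po using ga(1) by (intro mult_left_mono) auto
    have "alpha (t \<cdot>\<^sub>m R) i j - poly (message_poly n R (Suc s) i j) t
        = (t\<^sup>2 * (R $$ (i, j))\<^sup>2) * (1 / (1 - ?x) - (\<Sum>l\<le>s. ?y ^ l))"
      unfolding al po by (simp add: algebra_simps)
    also have "\<dots> \<le> (t * B) * (D * t ^ s)"
    proof (intro mult_mono)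
      show "t\<^sup>2 \<le> t" using t by (simp add: power2_eq_square mult_left_le)
      show "1 / (1 - ?x) - (\<Sum>l\<le>s. ?y ^ l) \<le> D * t ^ s" using ga(2) unfolding D_def by simp
    qed (use t B[OF ij] B0 ga(1) in auto)
    finally show "alpha (t \<cdot>\<^sub>m R) i j - poly (message_poly n R (Suc s) i j) t \<le> B * D * t ^ Suc s"
      by (simp add: algebra_simps)
  qed
qed

text \<open>The estimate for messages passes to the node factor; without a prefactor the order stays
  \<open>s\<close>.\<close>

lemma node_poly_approx:
  obtains C where "\<And>t i. 0 < t \<Longrightarrow> t \<le> 1 \<Longrightarrow> i < n \<Longrightarrow>
     poly (node_poly n R s i) t \<le> 1 / (1 - (\<Sum>k<n. alpha (t \<cdot>\<^sub>m R) k i)) \<and>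
     1 / (1 - (\<Sum>k<n. alpha (t \<cdot>\<^sub>m R) k i)) - poly (node_poly n R s i) t \<le> C * t ^ s"
proof -
  obtain C where C: "C \<ge> 0" and IH: "\<And>t i j. 0 < t \<Longrightarrow> t \<le> 1 \<Longrightarrow> i < n \<Longrightarrow> j < n \<Longrightarrow>
     poly (message_poly n R s i j) t \<le> alpha (t \<cdot>\<^sub>m R) i j \<and>
     alpha (t \<cdot>\<^sub>m R) i j - poly (message_poly n R s i j) t \<le> C * t ^ s"
    using message_poly_approx[of s] by blast
  define V where "V = (\<Sum>i<n. v i)"
  have V: "v i \<le> V" if "i < n" for i
    unfolding V_def using that by (intro member_le_sum) (auto intro: less_imp_le[OF v_pos])
  have V0: "V \<ge> 0" unfolding V_def by (intro sum_nonneg) (auto intro: less_imp_le[OF v_pos])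
  show ?thesis
  proof (rule that[of "V * (1 + (real s + 1) * (n * C))"])
    fix t i assume t: "0 < t" "t \<le> (1 :: real)" and i: "i < n"
    interpret T: gabp_matrix n "t \<cdot>\<^sub>m R" v by (rule scaled) (use t in auto)
    let ?x = "\<Sum>k<n. alpha (t \<cdot>\<^sub>m R) k i"
    let ?y = "\<Sum>k<n. poly (message_poly n R s k i) t"
    have "1 \<le> (1 - ?x) * v i" by (rule T.alpha_sum_le[OF i])
    also have "\<dots> \<le> (1 - ?x) * V"
      using V[OF i] T.alpha_sum_less_1[OF i] by (intro mult_left_mono) auto
    finally have x1: "1 \<le> (1 - ?x) * V" .
    have y0: "0 \<le> ?y" using t by (intro sum_nonneg nonneg_poly_nonneg nonneg_message_poly) auto
    have yx: "?y \<le> ?x" using IH t i by (intro sum_mono) auto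
    have "?x - ?y \<le> (\<Sum>k<n. C * t ^ s)"
      unfolding sum_subtractf[symmetric] using IH t i by (intro sum_mono) auto
    then have d: "?x - ?y \<le> (n * C) * t ^ s" by (simp add: mult.assoc)
    note ga = geometric_approx[OF y0 yx x1 scaled_sum_le[OF t i] t d V0, of s]
    show "poly (node_poly n R s i) t \<le> 1 / (1 - ?x) \<and>
        1 / (1 - ?x) - poly (node_poly n R s i) t \<le> V * (1 + (real s + 1) * (n * C)) * t ^ s"
      using ga by (simp add: node_poly_def poly_sum add.commute)
  qed
qed

end

subsection \<open>The bound\<close>

lemma det_2_of_rows:
  "det (mat_of_rows_list 2 [[a, b], [c, d]]) = a * d - b * (c :: 'a :: comm_ring_1)"
proof -
  define A where "A = mat_of_rows_list 2 [[a, b], [c, d]]"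
  have A: "A \<in> carrier_mat 2 2" by (rule carrier_matI) (simp_all add: A_def mat_of_rows_list_def)
  have e: "A $$ (0, 0) = a" "A $$ (0, 1) = b" "A $$ (1, 0) = c" "A $$ (1, 1) = d"
    by (simp_all add: A_def mat_of_rows_list_def)
  have s: "{..<2 :: nat} = {0, 1}" by auto
  have c: "det (mat_delete A 0 j) = mat_delete A 0 j $$ (0, 0)" for j
    by (rule det_single, rule carrier_matI) (simp_all add: mat_delete_def carrier_matD[OF A])
  have "det A = (\<Sum>j<2. A $$ (0, j) * cofactor A 0 j)" by (rule laplace_expansion_row[OF A]) simp
  also have "\<dots> = a * cofactor A 0 0 + b * cofactor A 0 1" unfolding s by (simp add: e[simplified])
  also have "cofactor A 0 0 = d"
    unfolding cofactor_def c using e by (simp add: mat_delete_def carrier_matD[OF A])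
  also have "cofactor A 0 1 = - c"
    unfolding cofactor_def c using e by (simp add: mat_delete_def carrier_matD[OF A])
  finally show ?thesis by (simp add: A_def)
qed

section \<open>The signed matrix compared with its absolute value\<close>

context gabp_matrix
begin

text \<open>Two instances share the messages: \<open>signed\<close> carries the determinant
  identity, and \<open>A\<close>, built on absolute values, supplies the bounds. Node factors
  coincide and edge weights agree up to sign.\<close>

sublocale signed: bp_fixpoint n "\<lambda>i j. R $$ (i, j)" "alpha R"
  by (rule is_bp_fixpoint)

sublocale A: bp_supersolution n "\<lambda>i j. \<bar>R $$ (i, j)\<bar>" "alpha R" v
  by (rule is_bp_supersolution)

lemma A_w: "i < n \<Longrightarrow> j < n \<Longrightarrow> A.w i j = \<bar>signed.w i j\<bar>"
  using signed.cavity_pos[of i j] by (simp add: A.w_def signed.w_def)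

lemma abs_signed_Mm_le: "e < n * n \<Longrightarrow> f < n * n \<Longrightarrow> \<bar>signed.Mm $$ (e, f)\<bar> \<le> A.Mm $$ (e, f)"
  by (simp add: signed.Mm_def A.Mm_def A_w edge_index_div_mod)

lemma alpha_eq_0: "i < n \<Longrightarrow> j < n \<Longrightarrow> R $$ (i, j) = 0 \<Longrightarrow> alpha R i j = 0"
  using alpha_eq[of i j] by simp

lemma Z_node_eq: "i < n \<Longrightarrow> Z_node R i = signed.z i"
  using sum_nbrs[of i "\<lambda>k. alpha R k i" "{}"]
  by (simp add: Z_node_def signed.z_def signed.node_def alpha_eq_0 inverse_eq_divide)

lemma alpha_excl_eq: "i < n \<Longrightarrow> j < n \<Longrightarrow> 1 - alpha_excl R i j = signed.cavity i j"
  using sum_nbrs[of i "\<lambda>k. alpha R k i" "{j}"] alpha_sum_diff[of j i]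
  by (simp add: alpha_excl_def signed.cavity_def signed.node_def alpha_eq_0)

text \<open>Substituting the fixed point equation for the squared entry factors the 2 by 2
  determinant into one cavity and one node denominator.\<close>

lemma edge_factor_eq:
  assumes ij: "i < n" "j < n"
  shows "Z_edge R i j / (Z_node R i * Z_node R j) = 1 - signed.w i j * signed.w j i"
proof -
  let ?c = "signed.cavity i j" and ?d = "signed.cavity j i"
  have "Z_edge R i j = inverse (?c * ?d - (R $$ (i, j))\<^sup>2)"
    unfolding Z_edge_def det_2_of_rows by (simp add: alpha_excl_eq ij power2_eq_square)
  also have "(R $$ (i, j))\<^sup>2 = alpha R i j * ?c"
    using alpha_fixpoint[OF ij] by (simp add: signed.cavity_def signed.node_def)
  also have "?c * ?d - alpha R i j * ?c = ?c * signed.node j"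
    by (simp add: signed.cavity_def[of j i] algebra_simps)
  finally show ?thesis
    unfolding signed.one_minus_ww[OF ij] Z_node_eq[OF ij(1)] Z_node_eq[OF ij(2)] signed.z_def
    using signed.node_pos[OF ij(1)] signed.node_pos[OF ij(2)] signed.cavity_pos[OF ij]
    by (simp add: field_simps)
qed

lemma signed_Rm: "signed.Rm = R"
  unfolding signed.Rm_def using R_carrier by (intro eq_matI) auto

lemma Z_ratio: "Z_bp R / Z_exact R = det (1\<^sub>m (n * n) - signed.Mm)"
proof -
  let ?E = "{(i, j). i < j \<and> gedge R i j}"
  let ?h = "\<lambda>p. if fst p < snd p then 1 - signed.w (fst p) (snd p) * signed.w (snd p) (fst p) else 1"
  have dim: "dim_row R = n" using R_carrier by simp
  have "(\<Prod>(i, j)\<in>?E. Z_edge R i j / (Z_node R i * Z_node R j)) = (\<Prod>p\<in>?E. ?h p)"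
    by (rule prod.cong) (auto simp: gedge_def dim edge_factor_eq)
  \<comment> \<open>Pairs that are not edges have weight 0 and contribute a factor 1.\<close>
  also have "\<dots> = (\<Prod>p\<in>{..<n} \<times> {..<n}. ?h p)"
    by (rule prod.mono_neutral_left) (auto simp: gedge_def dim signed.w_def)
  also have "\<dots> = (\<Prod>i<n. \<Prod>j<n. if i < j then 1 - signed.w i j * signed.w j i else 1)"
    by (simp add: prod.cartesian_product case_prod_unfold)
  finally have "Z_bp R = (\<Prod>i<n. signed.z i) *
      (\<Prod>i<n. \<Prod>j<n. if i < j then 1 - signed.w i j * signed.w j i else 1)"
    unfolding Z_bp_def dim by (simp add: Z_node_eq)
  then show ?thesis
    unfolding signed.det_one_minus_Mm signed_Rm Z_exact_def dim by (simp add: divide_inverse)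
qed

text \<open>By \<open>trace_gap_sums\<close> this is also the sum over \<open>k\<close> of the
  traces of \<open>A.Mm ^\<^sub>m k * A.Wm\<close>, hence nonnegative.\<close>

definition gap :: real where
  "gap = (\<Sum>k. mat_trace (A.Rm ^\<^sub>m k)) - (\<Sum>i<n. A.z i)"

definition girth_ge :: "nat \<Rightarrow> bool" where
  "girth_ge g \<longleftrightarrow> (\<forall>l<g. \<not> has_cycle_of_length R l)"

lemma trace_eq_0:
  assumes "girth_ge g" "Suc k < g" shows "mat_trace (A.Mm ^\<^sub>m k * A.Wm) = 0"
proof (rule A.trace_Mm_Wm_eq_0[OF _ assms(2)])
  fix l and y :: "nat \<Rightarrow> nat" assume l: "3 \<le> l" "l < g" "inj_on y {..<l}"
  then have "\<not> has_cycle_of_length R l" using assms(1) by (simp add: girth_ge_def)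
  then show "\<exists>i<l. \<not> (y i < n \<and> y (Suc i mod l) < n \<and> y i \<noteq> y (Suc i mod l) \<and> \<bar>R $$ (y i, y (Suc i mod l))\<bar> \<noteq> 0)"
    using l R_carrier unfolding has_cycle_of_length_def gedge_def by auto
qed

text \<open>The two series are compared term by term: for \<open>Suc k < g\<close> both terms
  vanish, and otherwise \<open>1 / Suc k\<close> is at most \<open>1 / g\<close>.\<close>

lemma abs_ln_ratio_le:
  assumes g: "girth_ge g" "g > 0"
  shows "\<bar>ln (Z_bp R / Z_exact R)\<bar> \<le> gap / g"
proof -
  obtain c where "weighted_contraction (n * n) A.Mm A.u c" by (rule A.Mm_contraction)
  then interpret M: weighted_contraction "n * n" A.Mm A.u c .
  let ?f = "\<lambda>k. mat_trace (signed.Mm ^\<^sub>m k) / k"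
  let ?b = "\<lambda>k. mat_trace (A.Mm ^\<^sub>m k * A.Wm) / g"
  have "norm e < 1" if "eigenvalue (map_mat complex_of_real signed.Mm) e" for e
    using eigenvalue_le_weight[OF signed.carriers(3) abs_signed_Mm_le M.weight_pos M.contr that] M.c_less by simp
  from ln_det_one_minus_series(2)[OF signed.carriers(3) this]
  have "?f sums (- ln (Z_bp R / Z_exact R))" unfolding Z_ratio .
  \<comment> \<open>The index can be shifted because the term at 0 is a division by zero and equals
    0.\<close>
  then have f: "(\<lambda>k. ?f (Suc k)) sums (- ln (Z_bp R / Z_exact R))" by (subst sums_Suc_iff) simp
  have b: "?b sums (gap / g)" unfolding gap_def by (intro sums_divide A.trace_gap_sums)
  have le: "\<bar>?f (Suc k)\<bar> \<le> ?b k" for k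
  proof -
    have "\<bar>mat_trace (signed.Mm ^\<^sub>m Suc k)\<bar> \<le> (\<Sum>e<n * n. \<bar>(signed.Mm ^\<^sub>m Suc k) $$ (e, e)\<bar>)"
      by (simp add: mat_trace_def del: pow_mat.simps)
    also have "\<dots> \<le> mat_trace (A.Mm ^\<^sub>m Suc k)"
      unfolding mat_trace_def pow_mat_dim_square[OF A.carriers(3)]
      by (intro sum_mono abs_pow_mat_le[OF signed.carriers(3) A.carriers(3) abs_signed_Mm_le]) auto
    also have "\<dots> \<le> mat_trace (A.Mm ^\<^sub>m k * A.Wm)" by (rule A.trace_Mm_Suc_le)
    finally have "\<bar>?f (Suc k)\<bar> \<le> mat_trace (A.Mm ^\<^sub>m k * A.Wm) / Suc k"
      by (simp add: divide_right_mono del: pow_mat.simps)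
    also have "\<dots> \<le> ?b k"
    proof (cases "Suc k < g")
      case False
      then show ?thesis using g A.trace_Mm_Wm_nonneg[of k] by (intro divide_left_mono) auto
    qed (simp add: trace_eq_0[OF g(1)])
    finally show ?thesis .
  qed
  have "summable (\<lambda>k. norm (?f (Suc k)))"
    by (rule summable_comparison_test'[OF sums_summable[OF b], of 0]) (use le in simp)
  then have "norm (\<Sum>k. ?f (Suc k)) \<le> (\<Sum>k. norm (?f (Suc k)))" by (rule summable_norm)
  also have "\<dots> \<le> (\<Sum>k. ?b k)"
    by (intro suminf_le sums_summable[OF b]) (use le \<open>summable (\<lambda>k. norm (?f (Suc k)))\<close> in auto)
  finally show ?thesis using sums_unique[OF f] sums_unique[OF b] by simp
qed

text \<open>Scaling by \<open>t\<close> enlarges the denominators, so every step weight shrinks at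
  least by the factor \<open>t\<close>. A closed walk of \<open>k + 1\<close> steps gains
  \<open>t ^ Suc k\<close>, and those shorter than \<open>g\<close> contribute nothing.\<close>

lemma gap_scaled_le:
  assumes t: "0 < t" "t \<le> 1" and g: "girth_ge g"
  shows "0 \<le> gabp_matrix.gap n (t \<cdot>\<^sub>m R)" "gabp_matrix.gap n (t \<cdot>\<^sub>m R) \<le> t ^ g * gap"
proof -
  interpret T: gabp_matrix n "t \<cdot>\<^sub>m R" v by (rule scaled) (use t in auto)
  have node: "A.node i \<le> T.A.node i" if "i < n" for i
    unfolding A.node_def T.A.node_def using that t alpha_scaled_le by (intro diff_left_mono sum_mono) auto
  have z: "T.A.z i \<le> A.z i" if "i < n" for i
    unfolding A.z_def T.A.z_def using node[OF that] A.node_pos[OF that] by (intro divide_left_mono) auto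
  have cav: "A.cavity i j \<le> T.A.cavity i j" if ij: "i < n" "j < n" for i j
  proof -
    have "(\<Sum>k\<in>{..<n} - {j}. alpha (t \<cdot>\<^sub>m R) k i) \<le> (\<Sum>k\<in>{..<n} - {j}. alpha R k i)"
      using that t alpha_scaled_le by (intro sum_mono) auto
    then show ?thesis
      by (simp add: A.cavity_def A.node_def T.A.cavity_def T.A.node_def alpha_sum_diff[OF ij(2)] T.alpha_sum_diff[OF ij(2)])
  qed
  have w: "T.A.w i j \<le> t * A.w i j" if ij: "i < n" "j < n" for i j
  proof -
    have "T.A.w i j = t * \<bar>R $$ (i, j)\<bar> / T.A.cavity i j"
      using ij R_carrier t by (simp add: T.A.w_def abs_mult)
    also have "\<dots> \<le> t * \<bar>R $$ (i, j)\<bar> / A.cavity i j"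
      using cav[OF ij] A.cavity_pos[OF ij] t by (intro divide_left_mono mult_pos_pos) auto
    finally show ?thesis by (simp add: A.w_def)
  qed
  have M: "\<bar>T.A.Mm $$ (e, f)\<bar> \<le> t * A.Mm $$ (e, f)" if "e < n * n" "f < n * n" for e f
    using w edge_index_div_mod[OF that(1)] T.A.w_nonneg that by (auto simp: A.Mm_entry T.A.Mm_entry)
  have W: "T.A.Wm $$ (e, f) \<le> t * A.Wm $$ (e, f)" if "e < n * n" "f < n * n" for e f
  proof -
    note d = edge_index_div_mod[OF that(1)]
    have "T.A.we e * T.A.z (e div n) \<le> (t * A.we e) * A.z (e div n)"
      using w[OF d] z[OF d(1)] T.A.z_ge_1[OF d(1)] A.w_nonneg[OF d] t by (intro mult_mono) auto
    then show ?thesis using that by (auto simp: A.Wm_def T.A.Wm_def mult.assoc)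
  qed
  have tr: "mat_trace (T.A.Mm ^\<^sub>m k * T.A.Wm) \<le> t ^ Suc k * mat_trace (A.Mm ^\<^sub>m k * A.Wm)" for k
  proof -
    have "(T.A.Mm ^\<^sub>m k) $$ (e, f) * T.A.Wm $$ (f, e) \<le> (t ^ k * (A.Mm ^\<^sub>m k) $$ (e, f)) * (t * A.Wm $$ (f, e))"
      if "e < n * n" "f < n * n" for e f
    proof (intro mult_mono)
      show "(T.A.Mm ^\<^sub>m k) $$ (e, f) \<le> t ^ k * (A.Mm ^\<^sub>m k) $$ (e, f)"
        using abs_pow_mat_le_scaled[OF T.A.carriers(3) A.carriers(3) M that, of k] by simp
    qed (use that t W T.A.Wm_nonneg A.Mm_pow_nonneg in auto)
    then have "mat_trace (T.A.Mm ^\<^sub>m k * T.A.Wm)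
        \<le> (\<Sum>e<n * n. \<Sum>f<n * n. (t ^ k * (A.Mm ^\<^sub>m k) $$ (e, f)) * (t * A.Wm $$ (f, e)))"
      unfolding T.A.trace_Mm_Wm_entry by (intro sum_mono) auto
    also have "\<dots> = t ^ Suc k * mat_trace (A.Mm ^\<^sub>m k * A.Wm)"
      unfolding A.trace_Mm_Wm_entry by (simp add: sum_distrib_left mult_ac)
    finally show ?thesis .
  qed
  have s: "(\<lambda>k. mat_trace (T.A.Mm ^\<^sub>m k * T.A.Wm)) sums T.gap"
    unfolding T.gap_def by (rule T.A.trace_gap_sums)
  show "0 \<le> T.gap" by (rule sums_le[OF _ sums_zero s]) (rule T.A.trace_Mm_Wm_nonneg)
  have s': "(\<lambda>k. t ^ g * mat_trace (A.Mm ^\<^sub>m k * A.Wm)) sums (t ^ g * gap)"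
    unfolding gap_def by (intro sums_mult A.trace_gap_sums)
  show "T.gap \<le> t ^ g * gap"
  proof (rule sums_le[OF _ s s'])
    fix k
    show "mat_trace (T.A.Mm ^\<^sub>m k * T.A.Wm) \<le> t ^ g * mat_trace (A.Mm ^\<^sub>m k * A.Wm)"
    proof (cases "Suc k < g")
      case True
      then show ?thesis using tr[of k] trace_eq_0[OF g True] by simp
    next
      case False
      then have "t ^ Suc k \<le> t ^ g" using t by (intro power_decreasing) auto
      then have "t ^ Suc k * mat_trace (A.Mm ^\<^sub>m k * A.Wm) \<le> t ^ g * mat_trace (A.Mm ^\<^sub>m k * A.Wm)"
        by (rule mult_right_mono) (rule A.trace_Mm_Wm_nonneg)
      then show ?thesis using tr[of k] by simp
    qed
  qed
qed

lemma trace_Rm_nonneg: "mat_trace (A.Rm ^\<^sub>m k) \<ge> 0"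
proof -
  have "0 \<le> (A.Rm ^\<^sub>m k) $$ (i, i)" if "i < n" for i
    using abs_pow_mat_le[of A.Rm n A.Rm i i k] that by (simp add: A.Rm_def)
  then show ?thesis by (auto simp: mat_trace_def intro!: sum_nonneg)
qed

lemma sum_trace_le_sum_z:
  assumes g: "girth_ge g"
  shows "(\<Sum>k<g. mat_trace (A.Rm ^\<^sub>m k)) \<le> (\<Sum>i<n. A.z i)"
proof -
  let ?T = "\<lambda>k. mat_trace (A.Rm ^\<^sub>m k)"
  define S where "S = (\<Sum>k. ?T (k + g))"
  define q where "q = (\<Sum>i<n. node_poly n R g i)"
  define p where "p = q - (\<Sum>k<g. monom (?T k) k)"
  obtain C where C: "\<And>t i. 0 < t \<Longrightarrow> t \<le> 1 \<Longrightarrow> i < n \<Longrightarrow>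
     poly (node_poly n R g i) t \<le> 1 / (1 - (\<Sum>k<n. alpha (t \<cdot>\<^sub>m R) k i)) \<and>
     1 / (1 - (\<Sum>k<n. alpha (t \<cdot>\<^sub>m R) k i)) - poly (node_poly n R g i) t \<le> C * t ^ g"
    using node_poly_approx[of g] by blast
  have sT: "summable ?T" by (rule A.trace_gap_sums)
  then have sTg: "summable (\<lambda>k. ?T (k + g))" by (rule summable_ignore_initial_segment)
  have "\<bar>poly p t\<bar> \<le> (n * C + gap + S) * t ^ g" if t: "0 < t" "t \<le> 1" for t
  proof -
    interpret T: gabp_matrix n "t \<cdot>\<^sub>m R" v by (rule scaled) (use t in auto)
    have z: "T.A.z i = 1 / (1 - (\<Sum>k<n. alpha (t \<cdot>\<^sub>m R) k i))" for i
      by (simp add: T.A.z_def T.A.node_def)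
    have "(\<Sum>i<n. T.A.z i) - poly q t = (\<Sum>i<n. T.A.z i - poly (node_poly n R g i) t)"
      by (simp add: q_def poly_sum sum_subtractf)
    moreover have "0 \<le> \<dots>" using C[OF t] by (intro sum_nonneg) (auto simp: z)
    moreover have "(\<Sum>i<n. T.A.z i - poly (node_poly n R g i) t) \<le> (\<Sum>i<n. C * t ^ g)"
      using C[OF t] by (intro sum_mono) (auto simp: z)
    ultimately have q: "0 \<le> (\<Sum>i<n. T.A.z i) - poly q t" "(\<Sum>i<n. T.A.z i) - poly q t \<le> n * C * t ^ g"
      by auto
    have "T.A.Rm = t \<cdot>\<^sub>m A.Rm"
      using R_carrier t by (intro eq_matI) (auto simp: T.A.Rm_def A.Rm_def abs_mult)
    then have Tt: "mat_trace (T.A.Rm ^\<^sub>m k) = t ^ k * ?T k" for k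
      by (simp add: pow_mat_smult[OF A.carriers(1)] mat_trace_def sum_distrib_left)
    have sTt: "summable (\<lambda>k. t ^ k * ?T k)" using T.A.trace_gap_sums(1) by (simp add: Tt)
    then have sTtg: "summable (\<lambda>k. t ^ (k + g) * ?T (k + g))" by (rule summable_ignore_initial_segment)
    let ?tail = "\<Sum>k. t ^ (k + g) * ?T (k + g)"
    have "(\<Sum>k. t ^ k * ?T k) = ?tail + (\<Sum>k<g. t ^ k * ?T k)"
      by (rule suminf_split_initial_segment[OF sTt])
    then have zeq: "(\<Sum>i<n. T.A.z i) = ?tail + (\<Sum>k<g. t ^ k * ?T k) - T.gap"
      by (simp add: T.gap_def Tt)
    have tail0: "0 \<le> ?tail" using t trace_Rm_nonneg by (intro suminf_nonneg sTtg) auto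
    have "?tail \<le> (\<Sum>k. t ^ g * ?T (k + g))"
    proof (intro suminf_le sTtg summable_mult sTg)
      fix k
      have "t ^ (k + g) \<le> t ^ g" using t by (intro power_decreasing) auto
      then show "t ^ (k + g) * ?T (k + g) \<le> t ^ g * ?T (k + g)"
        by (rule mult_right_mono) (rule trace_Rm_nonneg)
    qed
    also have "\<dots> = S * t ^ g" by (simp add: S_def suminf_mult[OF sTg])
    finally have tail: "?tail \<le> S * t ^ g" .
    have "poly p t = poly q t - (\<Sum>k<g. t ^ k * ?T k)"
      by (simp add: p_def poly_sum poly_monom mult.commute)
    \<comment> \<open>The tail, the gap and the minorant error are each nonnegative and bounded by a
      constant times \<open>t ^ g\<close>, so \<open>p\<close> can have no coefficient below
      \<open>g\<close>.\<close>
    also have "\<dots> = ?tail - T.gap - ((\<Sum>i<n. T.A.z i) - poly q t)" by (simp add: zeq)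
    finally have "\<bar>poly p t\<bar> \<le> ?tail + T.gap + ((\<Sum>i<n. T.A.z i) - poly q t)"
      using tail0 q(1) gap_scaled_le(1)[OF t g] by linarith
    also have "\<dots> \<le> S * t ^ g + t ^ g * gap + n * C * t ^ g"
      using tail q(2) gap_scaled_le(2)[OF t g] by linarith
    finally show ?thesis by (simp add: algebra_simps)
  qed
  then have "coeff p k = 0" if "k < g" for k using coeff_eq_0_of_bound that by blast
  then have "coeff q k = ?T k" if "k < g" for k
    using that by (auto simp: p_def coeff_sum dest!: spec)
  then have "(\<Sum>k<g. ?T k) = (\<Sum>k<g. coeff q k)" by simp
  also have "\<dots> \<le> poly q 1"
    unfolding q_def by (intro nonneg_poly_sum_coeff_le nonneg_poly_sum nonneg_node_poly)
  also have "\<dots> \<le> (\<Sum>i<n. A.z i)"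
    unfolding q_def poly_sum
  proof (rule sum_mono)
    fix i assume "i \<in> {..<n}"
    moreover have "1 \<cdot>\<^sub>m R = R" by (intro eq_matI) auto
    ultimately show "poly (node_poly n R g i) 1 \<le> A.z i" using C[of 1 i] by (simp add: A.z_def A.node_def)
  qed
  finally show ?thesis .
qed

text \<open>The first \<open>g\<close> traces in \<open>gap\<close> are absorbed by the node
  factors, leaving only the tail.\<close>

theorem abs_ln_ratio_le_tail:
  assumes g: "girth_ge g" "g > 0"
  shows "summable (\<lambda>k. mat_trace (A.Rm ^\<^sub>m (k + g)))"
    and "\<bar>ln (Z_bp R / Z_exact R)\<bar> \<le> (\<Sum>k. mat_trace (A.Rm ^\<^sub>m (k + g))) / g"
proof -
  have s: "summable (\<lambda>k. mat_trace (A.Rm ^\<^sub>m k))" by (rule A.trace_gap_sums)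
  then show "summable (\<lambda>k. mat_trace (A.Rm ^\<^sub>m (k + g)))" by (rule summable_ignore_initial_segment)
  have "gap \<le> (\<Sum>k. mat_trace (A.Rm ^\<^sub>m (k + g)))"
    using sum_trace_le_sum_z[OF g(1)] suminf_split_initial_segment[OF s, of g] by (simp add: gap_def)
  then have "gap / g \<le> (\<Sum>k. mat_trace (A.Rm ^\<^sub>m (k + g))) / g" by (rule divide_right_mono) simp
  then show "\<bar>ln (Z_bp R / Z_exact R)\<bar> \<le> (\<Sum>k. mat_trace (A.Rm ^\<^sub>m (k + g))) / g"
    using abs_ln_ratio_le[OF g] by simp
qed

end

theorem theorem3:
  fixes R :: "real mat" and n :: nat
  assumes "R \<in> carrier_mat n n"
    and "R\<^sup>T = R"
    and "\<forall>i<n. R $$ (i, i) = 0"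
    and "rho_abs R < 1"
    and "has_cycle R"
  shows "(1 / real n) * \<bar>ln (Z_bp R / Z_exact R)\<bar>
           \<le> rho_abs R ^ girth R / (real (girth R) * (1 - rho_abs R))"
proof -
  let ?\<rho> = "rho_abs R" and ?g = "girth R" and ?A = "map_mat complex_of_real (abs_mat R)"
  have cyc: "has_cycle_of_length R ?g"
    using assms(5) unfolding has_cycle_def girth_def by (metis LeastI)
  then have g: "?g > 0" by (auto simp: has_cycle_of_length_def)
  \<comment> \<open>A cycle has a vertex. Positivity makes the spectral radius an attained maximum
    and lets \<open>n\<close> cancel at the end.\<close>
  have n: "n > 0"
  proof -
    obtain y where "gedge R (y 0) (y (Suc 0 mod ?g))" using cyc g unfolding has_cycle_of_length_def by blast
    then show ?thesis using assms(1) by (auto simp: gedge_def)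
  qed
  have absR: "abs_mat R \<in> carrier_mat n n" using assms(1) by (simp add: abs_mat_def)
  then have cA: "?A \<in> carrier_mat n n" by simp
  have entry: "abs_mat R $$ (i, j) = \<bar>R $$ (i, j)\<bar>" if "i < n" "j < n" for i j
    using assms(1) that by (simp add: abs_mat_def)
  have nn: "abs_mat R $$ (i, j) \<ge> 0" if "i < n" "j < n" for i j using entry[OF that] by simp
  \<comment> \<open>The equation for \<open>v\<close> has slack exactly 1, which gives the
    supersolution inequality.\<close>
  obtain v where v: "\<And>i. i < n \<Longrightarrow> v i \<ge> 1" "\<And>i. i < n \<Longrightarrow> v i = 1 + (\<Sum>j<n. abs_mat R $$ (i, j) * v j)"
    using spectral_radius_less_1_supersolution[OF absR n _ assms(4)[unfolded rho_abs_def]] nn by blast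
  interpret gabp_matrix n R v
  proof
    show "R $$ (i, j) = R $$ (j, i)" if "i < n" "j < n" for i j
      using index_transpose_mat(1)[of j R i] assms(1,2) that by simp
    show "1 + (\<Sum>j<n. \<bar>R $$ (i, j)\<bar> * v j) \<le> v i" if "i < n" for i
      using v(2)[OF that] that by (simp add: entry)
  qed (use assms(1,3) v(1) in auto)
  have ge: "girth_ge ?g"
    unfolding girth_ge_def girth_def using not_less_Least by blast
  have \<rho>: "0 \<le> ?\<rho>"
    using spectral_radius_mem_max(1)[OF cA n] by (auto simp: rho_abs_def)
  have Rm: "A.Rm = abs_mat R" using absR by (intro eq_matI) (auto simp: A.Rm_def entry)
  \<comment> \<open>Each of the \<open>n\<close> eigenvalues has modulus at most the spectral
    radius.\<close>
  have tr: "mat_trace (A.Rm ^\<^sub>m k) \<le> n * ?\<rho> ^ k" for k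
  proof -
    have "norm (mat_trace (?A ^\<^sub>m k)) \<le> n * ?\<rho> ^ k"
      using spectral_radius_mem_max(2)[OF cA n]
      by (intro norm_mat_trace_pow_le[OF cA]) (auto simp: rho_abs_def spectrum_def)
    moreover have "mat_trace (?A ^\<^sub>m k) = complex_of_real (mat_trace (A.Rm ^\<^sub>m k))"
      unfolding map_mat_of_real_pow[OF absR] Rm by (rule mat_trace_map_mat[of _ n]) (use absR in simp)
    ultimately show ?thesis by simp
  qed
  have "(\<lambda>k. (n * ?\<rho> ^ ?g) * ?\<rho> ^ k) sums ((n * ?\<rho> ^ ?g) * (1 / (1 - ?\<rho>)))"
    using \<rho> assms(4) by (intro sums_mult geometric_sums) simp
  then have geo: "(\<lambda>k. n * ?\<rho> ^ (k + ?g)) sums (n * ?\<rho> ^ ?g / (1 - ?\<rho>))"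
    by (simp add: power_add mult_ac)
  have "(\<Sum>k. mat_trace (A.Rm ^\<^sub>m (k + ?g))) \<le> n * ?\<rho> ^ ?g / (1 - ?\<rho>)"
    by (rule sums_le[OF tr summable_sums[OF abs_ln_ratio_le_tail(1)[OF ge g]] geo])
  then have "(\<Sum>k. mat_trace (A.Rm ^\<^sub>m (k + ?g))) / ?g \<le> n * ?\<rho> ^ ?g / (1 - ?\<rho>) / ?g"
    by (rule divide_right_mono) simp
  then have "\<bar>ln (Z_bp R / Z_exact R)\<bar> \<le> n * ?\<rho> ^ ?g / (1 - ?\<rho>) / ?g"
    using abs_ln_ratio_le_tail(2)[OF ge g] by linarith
  then have "(1 / n) * \<bar>ln (Z_bp R / Z_exact R)\<bar> \<le> (1 / n) * (n * ?\<rho> ^ ?g / (1 - ?\<rho>) / ?g)"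
    by (rule mult_left_mono) simp
  also have "\<dots> = ?\<rho> ^ ?g / (?g * (1 - ?\<rho>))" using n by simp
  finally show ?thesis .
qed

end
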